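(* Up to isomorphism, there are exactly $6$ abelian groups in the class of groups $G(A)$ generated by invertible automata $A$ with $3$ states over a $2$-letter alphabet, namely: $\{1\}$ (generated by automaton number $1$), $C_2$ (automaton number $1090$), $C_2\times C_2$ (automaton number $730$), $C_2\times C_2\times C_2$ (automaton number $802$), $\mathbb{Z}$ (automaton number $731$), and $\mathbb{Z}^2$ (automaton number $771$).
   Context: A finite invertible automaton is a quadruple $A=(Q,X,\tau,\rho)$ where $Q$ is a finite set of states, $X$ is a finite alphabet, $\tau:Q\times X\to Q$ and $\rho:Q\times X\to X$ are maps such that for each $q\in Q$ the map $\rho_q:X\to X$, $\rho_q(x)=\rho(q,x)$, is a permutation of $X$. Each state $q$ defines an automorphism, also denoted $q$, of the rooted tree $X^*$ of finite words over $X$, recursively by $q(\emptyset)=\emptyset$ and $q(xw)=\rho_q(x)\,\tau(q,x)(w)$ for $x\in X$, $w\in X^*$. The automaton group $G(A)$ is the subgroup of $\mathrm{Aut}(X^* )$ generated by the automorphisms defined by the states. Here $|Q|=3$ and $|X|=2$; distinct states are allowed to define the same automorphism. $C_2$ is the cyclic group of order $2$. Notation for specific automata: $X=\{0,1\}$, $Q=\{a,b,c\}$; $\sigma$ denotes the transposition of $0$ and $1$; $q=\sigma(r,s)$ (respectively $q=(r,s)$) means $\rho_q=\sigma$ (respectively $\rho_q$ is the identity), $\tau(q,0)=r$, $\tau(q,1)=s$. The numbered automata are: number $1$: $a=(a,a),\ b=(a,a),\ c=(a,a)$; number $1090$: $a=\sigma(a,a),\ b=(b,b),\ c=(b,b)$;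 number $730$: $a=\sigma(a,a),\ b=(a,a),\ c=(a,a)$; number $802$: $a=\sigma(a,a),\ b=(c,c),\ c=(a,a)$; number $731$: $a=\sigma(b,a),\ b=(a,a),\ c=(a,a)$; number $771$: $a=\sigma(c,b),\ b=(b,b),\ c=(a,a)$. *)

theory Defs
  imports
    "HOL-Algebra.Bij"
    "HOL-Algebra.Elementary_Groups"
    "HOL-Combinatorics.Transposition"
begin

section \<open>Automorphisms of the rooted tree of finite words\<close>

definition child_of :: "'x list \<Rightarrow> 'x list \<Rightarrow> bool"
  where "child_of v u \<longleftrightarrow> (\<exists>x. v = u @ [x])"

definition tree_auts :: "'x set \<Rightarrow> ('x list \<Rightarrow> 'x list) set"
  where "tree_auts X = {f \<in> Bij (lists X).
    f [] = [] \<and> (\<forall>u\<in>lists X. \<forall>v\<in>lists X. child_of (f v) (f u) \<longleftrightarrow> child_of v u)}"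

definition tree_aut_group :: "'x set \<Rightarrow> ('x list \<Rightarrow> 'x list) monoid"
  where "tree_aut_group X = (BijGroup (lists X))\<lparr>carrier := tree_auts X\<rparr>"

section \<open>Automata and automaton groups\<close>

record ('q, 'x) automaton =
  states :: "'q set"
  alphabet :: "'x set"
  next_state :: "'q \<Rightarrow> 'x \<Rightarrow> 'q"
  out_letter :: "'q \<Rightarrow> 'x \<Rightarrow> 'x"

definition invertible_automaton :: "('q, 'x) automaton \<Rightarrow> bool"
  where "invertible_automaton A \<longleftrightarrow>
    finite (states A) \<and> finite (alphabet A) \<and>
    (\<forall>q\<in>states A. \<forall>x\<in>alphabet A. next_state A q x \<in> states A) \<and>
    (\<forall>q\<in>states A. bij_betw (out_letter A q) (alphabet A) (alphabet A))"

fun act :: "('q, 'x) automaton \<Rightarrow> 'q \<Rightarrow> 'x list \<Rightarrow> 'x list"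
  where
    "act A q [] = []"
  | "act A q (x # w) = out_letter A q x # act A (next_state A q x) w"

text \<open>Elements of \<^const>\<open>BijGroup\<close> are extensional functions, hence the restriction.\<close>

definition state_aut :: "('q, 'x) automaton \<Rightarrow> 'q \<Rightarrow> 'x list \<Rightarrow> 'x list"
  where "state_aut A q = restrict (act A q) (lists (alphabet A))"

text \<open>
  \<^const>\<open>subgroup_generated\<close> intersects the generators with the carrier of the ambient group;
  by \<open>state_aut_in_carrier\<close> below nothing is lost here.
\<close>

definition automaton_group :: "('q, 'x) automaton \<Rightarrow> ('x list \<Rightarrow> 'x list) monoid"
  where "automaton_group A =
    subgroup_generated (tree_aut_group (alphabet A)) (state_aut A ` states A)"

lemma tree_auts_subgroup: "subgroup (tree_auts X) (BijGroup (lists X))"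
proof
  show "tree_auts X \<subseteq> carrier (BijGroup (lists X))"
    by (auto simp: tree_auts_def BijGroup_def)
next
  fix f g assume fg: "f \<in> tree_auts X" "g \<in> tree_auts X"
  then have B: "f \<in> Bij (lists X)" "g \<in> Bij (lists X)" by (auto simp: tree_auts_def)
  have gm: "\<And>w. w \<in> lists X \<Longrightarrow> g w \<in> lists X" using Bij_imp_funcset[OF B(2)] by blast
  have "compose (lists X) f g \<in> tree_auts X"
    using fg compose_Bij[OF B] gm
    by (simp add: tree_auts_def compose_eq del: in_lists_conv_set)
  then show "f \<otimes>\<^bsub>BijGroup (lists X)\<^esub> g \<in> tree_auts X"
    using B by (simp add: BijGroup_def)
next
  show "\<one>\<^bsub>BijGroup (lists X)\<^esub> \<in> tree_auts X"
    using id_Bij[of "lists X"] by (simp add: tree_auts_def BijGroup_def)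
next
  fix f assume f: "f \<in> tree_auts X"
  then have B: "f \<in> Bij (lists X)" by (auto simp: tree_auts_def)
  then have bij: "bij_betw f (lists X) (lists X)" by (simp add: Bij_def)
  let ?g = "\<lambda>x\<in>lists X. inv_into (lists X) f x"
  have gm: "?g w \<in> lists X" "f (?g w) = w" if "w \<in> lists X" for w
    using that Bij_inv_into_mem[OF B] bij_betw_inv_into_right[OF bij]
    by (auto simp del: in_lists_conv_set)
  have f0: "f [] = []" using f by (simp add: tree_auts_def)
  have "?g [] = []"
    using bij_betw_inv_into_left[OF bij, of "[]"] f0 by simp
  moreover have "child_of (?g v) (?g u) \<longleftrightarrow> child_of v u"
    if "u \<in> lists X" "v \<in> lists X" for u v
  proof -
    have "\<forall>u\<in>lists X. \<forall>v\<in>lists X. child_of (f v) (f u) \<longleftrightarrow> child_of v u"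
      using f by (simp add: tree_auts_def)
    then have "child_of (f (?g v)) (f (?g u)) \<longleftrightarrow> child_of (?g v) (?g u)"
      using gm(1)[OF that(1)] gm(1)[OF that(2)] by blast
    then show ?thesis using gm(2)[OF that(1)] gm(2)[OF that(2)] by simp
  qed
  ultimately have "?g \<in> tree_auts X"
    using restrict_inv_into_Bij[OF B] unfolding tree_auts_def by blast
  then show "inv\<^bsub>BijGroup (lists X)\<^esub> f \<in> tree_auts X"
    using inv_BijGroup[OF B] by simp
qed

lemma group_tree_aut_group: "group (tree_aut_group X)"
  unfolding tree_aut_group_def
  by (rule subgroup.subgroup_is_group[OF tree_auts_subgroup group_BijGroup])

lemma group_automaton_group: "group (automaton_group A)"
  unfolding automaton_group_def by (rule group.group_subgroup_generated[OF group_tree_aut_group])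

lemma length_act [simp]: "length (act A q w) = length w"
  by (induction w arbitrary: q) auto

lemma act_in_lists:
  assumes "invertible_automaton A" "q \<in> states A" "w \<in> lists (alphabet A)"
  shows "act A q w \<in> lists (alphabet A)"
  using assms(2,3)
proof (induction w arbitrary: q)
  case (Cons x w)
  then show ?case using assms(1) unfolding invertible_automaton_def
    by (auto simp: bij_betw_apply)
qed simp

lemma act_inj:
  assumes "invertible_automaton A" "q \<in> states A"
    "u \<in> lists (alphabet A)" "v \<in> lists (alphabet A)" "act A q u = act A q v"
  shows "u = v"
  using assms(2-5)
proof (induction u arbitrary: q v)
  case Nil
  then show ?case by (cases v) auto
next
  case (Cons x u)
  then obtain y v' where v: "v = y # v'" by (cases v) auto
  have "inj_on (out_letter A q) (alphabet A)"
    using assms(1) Cons.prems(1) by (auto simp: invertible_automaton_def bij_betw_def)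
  then have xy: "x = y" using Cons.prems v by (auto dest: inj_onD)
  have "next_state A q x \<in> states A"
    using assms(1) Cons.prems by (auto simp: invertible_automaton_def)
  then show ?case using Cons.IH[of "next_state A q x" v'] Cons.prems v xy by auto
qed

lemma act_surj:
  assumes "invertible_automaton A" "q \<in> states A" "w \<in> lists (alphabet A)"
  shows "\<exists>u\<in>lists (alphabet A). act A q u = w"
  using assms(2,3)
proof (induction w arbitrary: q)
  case Nil
  then show ?case by (intro bexI[of _ "[]"]) auto
next
  case (Cons y w)
  have "out_letter A q ` alphabet A = alphabet A"
    using assms(1) Cons.prems(1) by (auto simp: invertible_automaton_def bij_betw_def)
  then obtain x where x: "x \<in> alphabet A" "out_letter A q x = y" using Cons.prems(2) by force
  have "next_state A q x \<in> states A"
    using assms(1) Cons.prems(1) x by (auto simp: invertible_automaton_def)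
  then obtain u where "u \<in> lists (alphabet A)" "act A (next_state A q x) u = w"
    using Cons.IH Cons.prems(2) by auto
  then show ?case using x by (intro bexI[of _ "x # u"]) auto
qed

lemma act_append: "\<exists>r. act A q (u @ w) = act A q u @ act A r w"
  by (induction u arbitrary: q) auto

lemma state_aut_in_carrier:
  assumes "invertible_automaton A" "q \<in> states A"
  shows "state_aut A q \<in> carrier (tree_aut_group (alphabet A))"
proof -
  let ?L = "lists (alphabet A)"
  have bij: "bij_betw (act A q) ?L ?L"
    unfolding bij_betw_def
  proof
    show "inj_on (act A q) ?L" using act_inj[OF assms] by (intro inj_onI) blast
    show "act A q ` ?L = ?L"
      using act_in_lists[OF assms] act_surj[OF assms] by blast
  qed
  have "bij_betw (state_aut A q) ?L ?L"
    using bij bij_betw_cong[of ?L "state_aut A q" "act A q" ?L] by (simp add: state_aut_def)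
  then have "state_aut A q \<in> Bij ?L" by (simp add: Bij_def state_aut_def)
  moreover have "child_of (act A q v) (act A q u) \<longleftrightarrow> child_of v u"
    if uv: "u \<in> ?L" "v \<in> ?L" for u v
  proof
    assume "child_of v u"
    then obtain x where "v = u @ [x]" by (auto simp: child_of_def)
    then show "child_of (act A q v) (act A q u)"
      using act_append[of A q u "[x]"] by (auto simp: child_of_def)
  next
    assume "child_of (act A q v) (act A q u)"
    then obtain y where y: "act A q v = act A q u @ [y]" by (auto simp: child_of_def)
    then have "length v = Suc (length u)" by (metis length_act length_append_singleton)
    then obtain v' x where v: "v = v' @ [x]" by (cases v rule: rev_cases) auto
    have "act A q v' = act A q u"
      using act_append[of A q v' "[x]"] y v by auto
    then have "v' = u" using act_inj[OF assms] uv v by auto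
    then show "child_of v u" using v by (auto simp: child_of_def)
  qed
  ultimately show ?thesis
    by (simp add: tree_aut_group_def tree_auts_def state_aut_def)
qed

section \<open>Three-state automata over the alphabet \<open>{0, 1}\<close>\<close>

datatype abc = qa | qb | qc

text \<open>
  The triple \<open>(\<pi>, r, s)\<close> assigned to a state \<open>q\<close> is its wreath recursion \<open>q = \<pi>(r, s)\<close>:
  \<open>q\<close> permutes the letters by \<open>\<pi>\<close> and passes to the state \<open>r\<close> on reading \<open>0\<close> and to \<open>s\<close>
  on reading \<open>1\<close>.
\<close>

type_synonym wreath_rec = "(nat \<Rightarrow> nat) \<times> abc \<times> abc"

definition wreath_automaton :: "wreath_rec \<Rightarrow> wreath_rec \<Rightarrow> wreath_rec \<Rightarrow> (abc, nat) automaton"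
  where "wreath_automaton ra rb rc =
    (let rec = case_abc ra rb rc in
     \<lparr>states = {qa, qb, qc}, alphabet = {0, 1},
      next_state = (\<lambda>q x. case rec q of (_, r, s) \<Rightarrow> if x = 0 then r else s),
      out_letter = (\<lambda>q. fst (rec q))\<rparr>)"

abbreviation swap01 :: "nat \<Rightarrow> nat"
  where "swap01 \<equiv> transpose 0 1"

definition aut1 :: "(abc, nat) automaton"
  where "aut1 = wreath_automaton (id, qa, qa) (id, qa, qa) (id, qa, qa)"

definition aut1090 :: "(abc, nat) automaton"
  where "aut1090 = wreath_automaton (swap01, qa, qa) (id, qb, qb) (id, qb, qb)"

definition aut730 :: "(abc, nat) automaton"
  where "aut730 = wreath_automaton (swap01, qa, qa) (id, qa, qa) (id, qa, qa)"

definition aut802 :: "(abc, nat) automaton"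
  where "aut802 = wreath_automaton (swap01, qa, qa) (id, qc, qc) (id, qa, qa)"

definition aut731 :: "(abc, nat) automaton"
  where "aut731 = wreath_automaton (swap01, qb, qa) (id, qa, qa) (id, qa, qa)"

definition aut771 :: "(abc, nat) automaton"
  where "aut771 = wreath_automaton (swap01, qc, qb) (id, qb, qb) (id, qa, qa)"

definition automaton_3_2 :: "('q, 'x) automaton \<Rightarrow> bool"
  where "automaton_3_2 A \<longleftrightarrow>
    invertible_automaton A \<and> card (states A) = 3 \<and> card (alphabet A) = 2"

abbreviation cyclic2 :: "int monoid" (\<open>C\<^sub>2\<close>)
  where "C\<^sub>2 \<equiv> integer_mod_group 2"

end

(*
  Let G be an abelian automaton group over a two-letter alphabet.  For a in G acting nontrivially on
  the first level (active), commutation with a forces the two sections of every inactive element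
  to coincide, and section-taking is injective on inactive elements.  A set of inactive elements
  closed under sections is trivial.

  Dichotomy: choose the least n > 0 such that g^n = 1 for some g ~= 1.  The n-torsion must contain
  an active element, so n is even, hence n = 2, and there is an active involution; then the squares
  are inactive and closed under sections, so all squares are trivial.  Hence G is torsion-free or
  an elementary abelian 2-group.  Three generators leave only 1, C_2, C_2^2, C_2^3 in the
  second case.

  In the torsion-free case one of the three generators is redundant.  With two active states this is
  the relation between their sections.  With one active state, an explicit word in the states
  is inactive and equal to its own section, hence trivial, and it expresses one state by the
  others.  So the rank is at most 2.
*)
theory Submission
  imports Defs
begin

section \<open>Abelian groups with few generators\<close>

text \<open>Every relation in the group is obtained from one device, \<open>faithful\<close>: an
  element is trivial once it lies in a set of inactive elements closed under sections. Active
  elements are out of its reach, so relations must be sought among words containing an even number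
  of active factors. With one active state x and inactive states whose sections run z to y to x,
  suitable words are eigenvectors. The section at 0 sends z to y, y to x and x^2 to the product P of
  the two sections of x. On exponents this is a linear map preserving the exponent sum, so 1 is an
  eigenvalue; the three possible P all admit an integral fixed vector with even x-exponent in which
  y or z has exponent 1, and that generator is redundant. With two active states, torsion-freeness
  excludes the degenerate case in which the relation between the sections only equates two squares.
  A torsion-free abelian group on two generators is then settled by Bezout: a nonzero relation is
  made primitive and completed to a basis of Z^2. The finite groups among the six differ in order; Z
  and Z^2 differ in being cyclic or not.\<close>

lemma (in comm_group) generate_pair:
  assumes "x \<in> carrier G" "y \<in> carrier G"
  shows "generate G {x, y} = (\<Union>i::int. \<Union>j::int. {x [^] i \<otimes> y [^] j})"
proof (rule generateI [symmetric])
  show "subgroup (\<Union>i::int. \<Union>j::int. {x [^] i \<otimes> y [^] j}) G"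
  proof (rule subgroupI)
    fix g assume "g \<in> (\<Union>i::int. \<Union>j::int. {x [^] i \<otimes> y [^] j})"
    then obtain i j :: int where g: "g = x [^] i \<otimes> y [^] j" by auto
    have "inv g = x [^] (- i) \<otimes> y [^] (- j)"
      using assms by (simp add: g inv_mult int_pow_neg)
    then show "inv g \<in> (\<Union>i::int. \<Union>j::int. {x [^] i \<otimes> y [^] j})" by blast
    fix h assume "h \<in> (\<Union>i::int. \<Union>j::int. {x [^] i \<otimes> y [^] j})"
    then obtain k l :: int where h: "h = x [^] k \<otimes> y [^] l" by auto
    have "g \<otimes> h = x [^] (i + k) \<otimes> y [^] (j + l)"
      using assms by (simp add: g h int_pow_mult m_ac)
    then show "g \<otimes> h \<in> (\<Union>i::int. \<Union>j::int. {x [^] i \<otimes> y [^] j})" by blast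
  qed (use assms in auto)
  have "x = x [^] (1::int) \<otimes> y [^] (0::int)" "y = x [^] (0::int) \<otimes> y [^] (1::int)"
    using assms by auto
  then show "{x, y} \<subseteq> (\<Union>i::int. \<Union>j::int. {x [^] i \<otimes> y [^] j})" by blast
  fix H assume H: "subgroup H G" "{x, y} \<subseteq> H"
  show "(\<Union>i::int. \<Union>j::int. {x [^] i \<otimes> y [^] j}) \<subseteq> H"
    using H by (auto intro!: subgroup.m_closed subgroup_int_pow_closed)
qed

lemma (in group) iso_integer_group:
  assumes x: "x \<in> carrier G" and gen: "carrier G = generate G {x}"
    and free: "\<And>i::int. x [^] i = \<one> \<Longrightarrow> i = 0"
  shows "G \<cong> integer_group"
proof -
  have "(\<lambda>i::int. x [^] i) \<in> iso integer_group G"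
    unfolding iso_iff
  proof (intro conjI)
    show "(\<lambda>i::int. x [^] i) \<in> hom integer_group G" by (rule hom_integer_group_pow[OF x])
    show "(\<lambda>i::int. x [^] i) ` carrier integer_group = carrier G"
      using x gen generate_pow[OF x] by auto
    show "inj_on (\<lambda>i::int. x [^] i) (carrier integer_group)"
    proof (rule inj_onI)
      fix i j :: int assume "x [^] i = x [^] j"
      then have "x [^] (i - j) = \<one>" using x by (simp add: int_pow_diff)
      then show "i = j" using free by fastforce
    qed
  qed
  then show ?thesis
    by (meson group.iso_sym group_integer_group is_isoI)
qed

lemma (in comm_group) iso_integer_group_squared:
  assumes xy: "x \<in> carrier G" "y \<in> carrier G" and gen: "carrier G = generate G {x, y}"
    and free: "\<And>(i::int) j::int. x [^] i \<otimes> y [^] j = \<one> \<Longrightarrow> i = 0 \<and> j = 0"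
  shows "G \<cong> integer_group \<times>\<times> integer_group"
proof -
  let ?f = "\<lambda>(i::int, j::int). x [^] i \<otimes> y [^] j"
  have "?f \<in> iso (integer_group \<times>\<times> integer_group) G"
    unfolding iso_iff
  proof (intro conjI)
    show "?f \<in> hom (integer_group \<times>\<times> integer_group) G"
      using xy by (auto simp: hom_def int_pow_mult m_ac)
    show "?f ` carrier (integer_group \<times>\<times> integer_group) = carrier G"
      unfolding gen generate_pair[OF xy] by auto
    show "inj_on ?f (carrier (integer_group \<times>\<times> integer_group))"
    proof (rule inj_onI, clarsimp)
      fix i j k l :: int assume *: "x [^] i \<otimes> y [^] j = x [^] k \<otimes> y [^] l"
      have "x [^] (i - k) \<otimes> y [^] (j - l) = (x [^] i \<otimes> y [^] j) \<otimes> inv (x [^] k \<otimes> y [^] l)"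
        using xy by (simp add: int_pow_diff inv_mult m_ac)
      also have "\<dots> = \<one>" using xy by (simp add: *)
      finally show "i = k \<and> j = l" using free[of "i - k" "j - l"] by simp
    qed
  qed
  then show ?thesis
    by (meson DirProd_group group.iso_sym group_integer_group is_isoI)
qed

section \<open>Torsion-free abelian groups on two generators\<close>

definition torsion_free :: "('a, 'b) monoid_scheme \<Rightarrow> bool"
  where "torsion_free G \<longleftrightarrow> (\<forall>x\<in>carrier G. \<forall>n::nat. 0 < n \<longrightarrow> x [^]\<^bsub>G\<^esub> n = \<one>\<^bsub>G\<^esub> \<longrightarrow> x = \<one>\<^bsub>G\<^esub>)"

lemma (in group) torsion_free_int_pow:
  assumes "torsion_free G" "x \<in> carrier G" "x [^] (i::int) = \<one>"
  shows "i = 0 \<or> x = \<one>"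
proof (cases i)
  case (nonneg n)
  then show ?thesis using assms by (auto simp: torsion_free_def int_pow_int)
next
  case (neg n)
  then have "inv (x [^] (Suc n)) = \<one>"
    using assms(2,3) int_pow_neg_int[of x "Suc n"] by metis
  then have "x [^] (Suc n) = \<one>"
    using assms(2) by (metis inv_eq_1_iff nat_pow_closed)
  then show ?thesis using assms(1,2) unfolding torsion_free_def by blast
qed

text \<open>In a torsion-free group a nontrivial relation can be divided by the gcd of its
  exponents. The primitive vector so obtained belongs to a basis of Z^2, and the other basis vector
  yields a single generator.\<close>

lemma (in comm_group) torsion_free_generate_pair_cases:
  assumes tf: "torsion_free G" and xy: "x \<in> carrier G" "y \<in> carrier G"
    and gen: "carrier G = generate G {x, y}"
  shows "carrier G = {\<one>} \<or> G \<cong> integer_group \<or> G \<cong> integer_group \<times>\<times> integer_group"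
proof (cases "\<exists>(i::int) j::int. x [^] i \<otimes> y [^] j = \<one> \<and> \<not> (i = 0 \<and> j = 0)")
  case False
  then show ?thesis using iso_integer_group_squared[OF xy gen] by blast
next
  case True
  then obtain i j :: int where ij: "x [^] i \<otimes> y [^] j = \<one>" "\<not> (i = 0 \<and> j = 0)" by blast
  define d where "d = gcd i j"
  obtain i' j' where i': "i = i' * d" and j': "j = j' * d"
    unfolding d_def by (metis gcd_dvd1 gcd_dvd2 dvdE mult.commute)
  have d0: "d \<noteq> 0" using ij(2) by (simp add: d_def)
  have "coprime i' j'"
  proof -
    have "gcd (i' * d) (j' * d) = d" using d_def i' j' by simp
    moreover have "gcd (i' * d) (j' * d) = gcd i' j' * \<bar>d\<bar>" using gcd_mult_distrib_int[of d i' j'] by (simp add: mult.commute)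
    moreover have "d > 0" using d0 by (simp add: d_def)
    ultimately have "gcd i' j' = 1" by simp
    then show ?thesis by (simp add: coprime_iff_gcd_eq_1)
  qed
  then obtain u v where uv: "u * i' + v * j' = 1"
    using bezout_int[of i' j'] by auto
  have "(x [^] i' \<otimes> y [^] j') [^] d = \<one>"
    using ij(1) xy by (simp add: int_pow_distrib int_pow_pow i' j')
  then have r: "x [^] i' \<otimes> y [^] j' = \<one>"
    using torsion_free_int_pow[OF tf] d0 xy by blast
  \<comment> \<open>By \<open>uv\<close>, (1, 0) = u (i', j') + j' (v, -u) and (0, 1) = v (i', j') -
    i' (v, -u). The vector (i', j') dies in the group by \<open>r\<close>, so \<open>x\<close> and
    \<open>y\<close> are powers of \<open>w\<close>, the image of (v, -u).\<close>
  define w where "w = x [^] v \<otimes> y [^] (- u)"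
  have w: "w \<in> carrier G" using xy by (simp add: w_def)
  have "w [^] j' = x [^] (v * j') \<otimes> y [^] (- (u * j'))"
    using xy by (simp add: w_def int_pow_distrib int_pow_pow)
  also have "v * j' = 1 - u * i'" using uv by simp
  also have "x [^] (1 - u * i') \<otimes> y [^] (- (u * j')) = x \<otimes> inv ((x [^] i' \<otimes> y [^] j') [^] u)"
    using xy by (simp add: int_pow_diff int_pow_neg int_pow_distrib int_pow_pow inv_mult m_ac mult.commute[of u])
  finally have xw: "x = w [^] j'" using r xy by simp
  have "w [^] (- i') = x [^] (- (v * i')) \<otimes> y [^] (u * i')"
    using xy by (simp add: w_def int_pow_distrib int_pow_pow)
  also have "u * i' = 1 - v * j'" using uv by simp
  also have "x [^] (- (v * i')) \<otimes> y [^] (1 - v * j') = y \<otimes> inv ((x [^] i' \<otimes> y [^] j') [^] v)"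
    using xy by (simp add: int_pow_diff int_pow_neg int_pow_distrib int_pow_pow inv_mult m_ac mult.commute[of v])
  finally have yw: "y = w [^] (- i')" using r xy by simp
  have "generate G {x, y} \<subseteq> generate G {w}"
  proof (rule generate_subgroup_incl)
    show "{x, y} \<subseteq> generate G {w}"
      unfolding generate_pow[OF w] using xw yw by blast
    show "subgroup (generate G {w}) G" using w by (intro generate_is_subgroup) auto
  qed
  moreover have "generate G {w} \<subseteq> carrier G" using w by (intro generate_incl) auto
  ultimately have g: "carrier G = generate G {w}" using gen by blast
  show ?thesis
  proof (cases "w = \<one>")
    case True
    then show ?thesis using g by (simp add: generate_one)
  next
    case False
    then have "G \<cong> integer_group"
      using iso_integer_group[OF w g] torsion_free_int_pow[OF tf w] by blast
    then show ?thesis by blast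
  qed
qed

section \<open>Elementary abelian 2-groups, built by adjoining one involution at a time\<close>

definition elementary_2 :: "('a, 'b) monoid_scheme \<Rightarrow> bool"
  where "elementary_2 G \<longleftrightarrow> (\<forall>x\<in>carrier G. x \<otimes>\<^bsub>G\<^esub> x = \<one>\<^bsub>G\<^esub>)"

text \<open>Since \<open>x\<close> is its own inverse, a product of two elements of the coset falls
  back into \<open>K\<close>: x k x l = k l.\<close>

lemma (in comm_group) subgroup_Un_l_coset:
  assumes K: "subgroup K G" and x: "x \<in> carrier G" "x \<otimes> x = \<one>"
  shows "subgroup (K \<union> (x <# K)) G"
proof (rule subgroupI)
  have KG: "k \<in> carrier G" if "k \<in> K" for k using K that by (rule subgroup.mem_carrier)
  have m: "k \<otimes> l \<in> K" "inv k \<in> K" if "k \<in> K" "l \<in> K" for k l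
    using K that by (auto simp: subgroup.m_closed subgroup.m_inv_closed)
  have ix: "inv x = x" using x by (metis inv_equality)
  have xkl: "x \<otimes> k \<otimes> (x \<otimes> l) = k \<otimes> l" if "k \<in> carrier G" "l \<in> carrier G" for k l
  proof -
    have "x \<otimes> k \<otimes> (x \<otimes> l) = (x \<otimes> x) \<otimes> (k \<otimes> l)" using that x(1) by (simp only: m_ac m_closed)
    then show ?thesis using that x by simp
  qed
  show "K \<union> (x <# K) \<subseteq> carrier G" using KG x by (auto simp: l_coset_def)
  show "K \<union> (x <# K) \<noteq> {}" using subgroup.one_closed[OF K] by blast
  fix g assume g: "g \<in> K \<union> (x <# K)"
  then show "inv g \<in> K \<union> (x <# K)"
    using KG x m by (auto simp: l_coset_def inv_mult ix)
  fix h assume h: "h \<in> K \<union> (x <# K)"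
  have *: "k \<otimes> (x \<otimes> l) = x \<otimes> (k \<otimes> l)" "x \<otimes> k \<otimes> l = x \<otimes> (k \<otimes> l)" if "k \<in> K" "l \<in> K" for k l
    using that KG x(1) by (simp_all add: m_lcomm m_assoc)
  show "g \<otimes> h \<in> K \<union> (x <# K)"
    using g h m KG x xkl by (auto simp: l_coset_def *)
qed

text \<open>The isomorphism sends (i, k) to x^i k. Its injectivity rests on
  \<open>x \<notin> K\<close>, which keeps the coset disjoint from \<open>K\<close>.\<close>

lemma (in comm_group) iso_C2_DirProd:
  assumes K: "subgroup K G" and x: "x \<in> carrier G" "x \<otimes> x = \<one>" "x \<notin> K"
  shows "G\<lparr>carrier := K \<union> (x <# K)\<rparr> \<cong> C\<^sub>2 \<times>\<times> G\<lparr>carrier := K\<rparr>"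
proof -
  have KG: "k \<in> carrier G" if "k \<in> K" for k using K that by (rule subgroup.mem_carrier)
  have m: "k \<otimes> l \<in> K" "inv k \<in> K" if "k \<in> K" "l \<in> K" for k l
    using K that by (auto simp: subgroup.m_closed subgroup.m_inv_closed)
  have xk: "x \<otimes> k \<notin> K" if "k \<in> K" for k
  proof
    assume "x \<otimes> k \<in> K"
    then have "x \<otimes> k \<otimes> inv k \<in> K" using m that by blast
    then show False using x KG that by (simp add: m_assoc)
  qed
  have xkl: "x \<otimes> k \<otimes> (x \<otimes> l) = k \<otimes> l" if "k \<in> K" "l \<in> K" for k l
  proof -
    have "x \<otimes> k \<otimes> (x \<otimes> l) = (x \<otimes> x) \<otimes> (k \<otimes> l)"
      using that x(1) KG by (simp only: m_ac m_closed)
    then show ?thesis using that x KG by simp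
  qed
  have c2: "carrier C\<^sub>2 = {0, 1}" by (auto simp: carrier_integer_mod_group)
  let ?f = "\<lambda>(i::int, k). if i = 0 then k else x \<otimes> k"
  have "?f \<in> iso (C\<^sub>2 \<times>\<times> G\<lparr>carrier := K\<rparr>) (G\<lparr>carrier := K \<union> (x <# K)\<rparr>)"
    unfolding iso_iff
  proof (intro conjI)
    show "?f \<in> hom (C\<^sub>2 \<times>\<times> G\<lparr>carrier := K\<rparr>) (G\<lparr>carrier := K \<union> (x <# K)\<rparr>)"
      using x KG xkl m by (auto simp: hom_def c2 l_coset_def m_ac)
    show "?f ` carrier (C\<^sub>2 \<times>\<times> G\<lparr>carrier := K\<rparr>) = carrier (G\<lparr>carrier := K \<union> (x <# K)\<rparr>)"
      by (force simp: c2 l_coset_def image_iff)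
    show "inj_on ?f (carrier (C\<^sub>2 \<times>\<times> G\<lparr>carrier := K\<rparr>))"
      using xk KG x by (auto simp: inj_on_def c2)
  qed
  moreover have "group (C\<^sub>2 \<times>\<times> G\<lparr>carrier := K\<rparr>)"
    by (intro DirProd_group subgroup.subgroup_is_group[OF K]) auto
  ultimately show ?thesis by (meson group.iso_sym is_isoI)
qed

text \<open>The carrier is written as a one-step extension of the trivial subgroup: it then matches
  the start of the chain of extensions, and the chain begins with \<open>C\<^sub>2\<close> itself
  instead of its product with a trivial group.\<close>

lemma (in comm_group) iso_C2_of_involution:
  assumes x: "x \<in> carrier G" "x \<otimes> x = \<one>" "x \<noteq> \<one>"
  shows "G\<lparr>carrier := {\<one>} \<union> (x <# {\<one>})\<rparr> \<cong> C\<^sub>2"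
proof -
  let ?f = "\<lambda>i::int. if i = 0 then \<one> else x"
  have c2: "carrier C\<^sub>2 = {0, 1}" by (auto simp: carrier_integer_mod_group)
  have "?f \<in> iso C\<^sub>2 (G\<lparr>carrier := {\<one>} \<union> (x <# {\<one>})\<rparr>)"
    unfolding iso_iff using x by (auto simp: hom_def c2 l_coset_def inj_on_def)
  moreover have "group C\<^sub>2" by simp
  ultimately show ?thesis by (meson group.iso_sym is_isoI)
qed


lemma (in comm_group) elementary_2_adjoin:
  assumes "elementary_2 G" "subgroup K G" "x \<in> carrier G"
  shows "K \<union> (x <# K) = K \<or> G\<lparr>carrier := K \<union> (x <# K)\<rparr> \<cong> C\<^sub>2 \<times>\<times> G\<lparr>carrier := K\<rparr>"
proof (cases "x \<in> K")
  case True
  then show ?thesis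
    using assms(2) by (auto simp: l_coset_def subgroup.m_closed)
next
  case False
  then show ?thesis using iso_C2_DirProd assms by (auto simp: elementary_2_def)
qed

lemma C2_DirProd_iso: "C\<^sub>2 \<times>\<times> H \<cong> C\<^sub>2 \<times>\<times> K" if "H \<cong> K"
  by (rule group.DirProd_iso_trans[OF group_integer_mod_group iso_refl that])

text \<open>The generators are adjoined in turn to the trivial subgroup. Each step changes nothing
  or contributes one factor \<open>C\<^sub>2\<close>, and the third subgroup contains all
  generators.\<close>

lemma (in comm_group) elementary_2_three_generators:
  assumes el: "elementary_2 G" and xyz: "x \<in> carrier G" "y \<in> carrier G" "z \<in> carrier G"
    and gen: "carrier G = generate G {x, y, z}"
  shows "carrier G = {\<one>} \<or> G \<cong> C\<^sub>2 \<or> G \<cong> C\<^sub>2 \<times>\<times> C\<^sub>2 \<or> G \<cong> C\<^sub>2 \<times>\<times> C\<^sub>2 \<times>\<times> C\<^sub>2"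
proof -
  define ext where "ext K x = K \<union> (x <# K)" for K x
  let ?r = "\<lambda>K. G\<lparr>carrier := K\<rparr>"
  have sub: "subgroup (ext K g) G" if "subgroup K G" "g \<in> carrier G" for K g
    unfolding ext_def using subgroup_Un_l_coset[OF that] el that by (simp add: elementary_2_def)
  have mem: "g \<in> ext K g" "K \<subseteq> ext K g" if "subgroup K G" "g \<in> carrier G" for K g
    using that subgroup.one_closed[OF that(1)]
    by (auto simp: ext_def l_coset_def intro!: bexI[of _ \<one>])
  have one: "ext {\<one>} g = {\<one>} \<or> ?r (ext {\<one>} g) \<cong> C\<^sub>2" if "g \<in> carrier G" for g
  proof (cases "g = \<one>")
    case True
    then show ?thesis by (auto simp: ext_def l_coset_def)
  next
    case False
    then show ?thesis
      using iso_C2_of_involution[OF that] el that by (simp add: elementary_2_def ext_def)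
  qed
  have step: "?r (ext K g) \<cong> H \<or> ?r (ext K g) \<cong> C\<^sub>2 \<times>\<times> H"
    if "subgroup K G" "g \<in> carrier G" "?r K \<cong> H" for K g and H
  proof -
    have "ext K g = K \<or> ?r (ext K g) \<cong> C\<^sub>2 \<times>\<times> ?r K"
      unfolding ext_def by (rule elementary_2_adjoin[OF el that(1,2)])
    then show ?thesis
    proof
      assume "ext K g = K"
      then show ?thesis using that(3) by simp
    next
      assume "?r (ext K g) \<cong> C\<^sub>2 \<times>\<times> ?r K"
      then show ?thesis using iso_trans[OF _ C2_DirProd_iso[OF that(3)]] by blast
    qed
  qed
  define K1 where "K1 = ext {\<one>} x"
  define K2 where "K2 = ext K1 y"
  define K3 where "K3 = ext K2 z"
  have s: "subgroup {\<one>} G" "subgroup K1 G" "subgroup K2 G" "subgroup K3 G"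
    using sub xyz triv_subgroup by (simp_all add: K1_def K2_def K3_def)
  have "{x, y, z} \<subseteq> K3"
    using mem(1)[OF s(1) xyz(1)] mem[OF s(2) xyz(2)] mem[OF s(3) xyz(3)]
    unfolding K1_def[symmetric] K2_def[symmetric] K3_def[symmetric] by auto
  then have "carrier G \<subseteq> K3" using gen generate_subgroup_incl[OF _ s(4)] by blast
  then have K3: "K3 = carrier G" using s(4) subgroup.subset by blast
  have "K1 = {\<one>} \<or> ?r K1 \<cong> C\<^sub>2" using one xyz by (simp add: K1_def)
  then have "K2 = {\<one>} \<or> ?r K2 \<cong> C\<^sub>2 \<or> ?r K2 \<cong> C\<^sub>2 \<times>\<times> C\<^sub>2"
  proof
    assume "K1 = {\<one>}"
    then show ?thesis using one[OF xyz(2)] unfolding K2_def by blast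
  next
    assume "?r K1 \<cong> C\<^sub>2"
    then show ?thesis using step[OF s(2) xyz(2)] unfolding K2_def by blast
  qed
  then consider "K2 = {\<one>}" | "?r K2 \<cong> C\<^sub>2" | "?r K2 \<cong> C\<^sub>2 \<times>\<times> C\<^sub>2" by blast
  then have "K3 = {\<one>} \<or> ?r K3 \<cong> C\<^sub>2 \<or> ?r K3 \<cong> C\<^sub>2 \<times>\<times> C\<^sub>2 \<or> ?r K3 \<cong> C\<^sub>2 \<times>\<times> C\<^sub>2 \<times>\<times> C\<^sub>2"
  proof cases
    case 1
    then show ?thesis using one[OF xyz(3)] unfolding K3_def by blast
  next
    case 2
    then show ?thesis using step[OF s(3) xyz(3)] unfolding K3_def by blast
  next
    case 3
    then show ?thesis using step[OF s(3) xyz(3)] unfolding K3_def by blast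
  qed
  then show ?thesis by (simp add: K3)
qed

lemma (in group) generate_insert_redundant:
  assumes "S \<subseteq> carrier G" "x \<in> generate G S"
  shows "generate G (insert x S) = generate G S"
proof
  show "generate G (insert x S) \<subseteq> generate G S"
    using assms by (intro generate_subgroup_incl generate_is_subgroup) (auto intro: generate.incl)
qed (intro mono_generate subset_insertI)

text \<open>The coset description lists generated subgroups element by element, which turns
  independence of the generators of a concrete automaton into a finite check.\<close>

lemma (in comm_group) elementary_2_generate_insert:
  assumes "elementary_2 G" "S \<subseteq> carrier G" "x \<in> carrier G"
  shows "generate G (insert x S) = generate G S \<union> (x <# generate G S)"
proof
  have s: "subgroup (generate G S) G" using assms by (intro generate_is_subgroup)
  show "generate G (insert x S) \<subseteq> generate G S \<union> (x <# generate G S)"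
  proof (rule generate_subgroup_incl)
    show "subgroup (generate G S \<union> (x <# generate G S)) G"
      using assms by (intro subgroup_Un_l_coset s) (auto simp: elementary_2_def)
    have "x = x \<otimes> \<one>" using assms by simp
    then have "x \<in> x <# generate G S" using generate.one[of G S] unfolding l_coset_def by blast
    then show "insert x S \<subseteq> generate G S \<union> (x <# generate G S)" by (auto intro: generate.incl)
  qed
  have 1: "generate G S \<subseteq> generate G (insert x S)" by (intro mono_generate subset_insertI)
  moreover have "x <# generate G S \<subseteq> generate G (insert x S)"
    using 1 generate.incl[of x "insert x S" G] by (auto simp: l_coset_def intro: generate.eng)
  ultimately show "generate G S \<union> (x <# generate G S) \<subseteq> generate G (insert x S)" by blast
qed

lemma (in comm_group) elementary_2_iso_C2_DirProd_generate:
  assumes "elementary_2 G" "S \<subseteq> carrier G" "x \<in> carrier G" "x \<notin> generate G S"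
  shows "G\<lparr>carrier := generate G (insert x S)\<rparr> \<cong> C\<^sub>2 \<times>\<times> G\<lparr>carrier := generate G S\<rparr>"
  unfolding elementary_2_generate_insert[OF assms(1-3)]
  using assms by (intro iso_C2_DirProd generate_is_subgroup) (auto simp: elementary_2_def)

lemma (in comm_group) elementary_2_generate_singleton:
  assumes "elementary_2 G" "x \<in> carrier G"
  shows "generate G {x} = {\<one>, x}"
  using elementary_2_generate_insert[of "{}" x] assms by (auto simp: generate_empty l_coset_def)

lemma (in comm_group) elementary_2_generate_doubleton:
  assumes "elementary_2 G" "x \<in> carrier G" "y \<in> carrier G"
  shows "generate G {x, y} = {\<one>, y, x, x \<otimes> y}"
  using elementary_2_generate_insert[of "{y}" x] elementary_2_generate_singleton[of y] assms
  by (auto simp: l_coset_def)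

lemma (in comm_group) elementary_2_iso_C2:
  assumes "elementary_2 G" "x \<in> carrier G" "x \<noteq> \<one>"
  shows "G\<lparr>carrier := generate G {x}\<rparr> \<cong> C\<^sub>2"
  using iso_C2_of_involution[of x] elementary_2_generate_insert[of "{}" x] assms
  by (simp add: generate_empty elementary_2_def)

lemma (in group) trivial_iso_singleton_group:
  assumes "carrier G = {\<one>}"
  shows "G \<cong> singleton_group a"
proof -
  have "(\<lambda>_. a) \<in> iso G (singleton_group a)"
    unfolding iso_iff using assms by (simp add: hom_def singleton_group_def)
  then show ?thesis by (rule is_isoI)
qed

text \<open>A multiple of (p, q) equal to (1, 0) forces q = 0, whereas a multiple equal to (0, 1)
  needs q nonzero.\<close>

lemma integer_group_squared_not_cyclic: "\<not> cyclic_group (integer_group \<times>\<times> integer_group)"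
proof
  assume *: "cyclic_group (integer_group \<times>\<times> integer_group)"
  have grp: "group (integer_group \<times>\<times> integer_group)" by (simp add: DirProd_group)
  have hom: "fst \<in> hom (integer_group \<times>\<times> integer_group) integer_group"
    "snd \<in> hom (integer_group \<times>\<times> integer_group) integer_group"
    by (auto simp: hom_def mult_DirProd')
  obtain g where g: "carrier (integer_group \<times>\<times> integer_group) =
      range (\<lambda>n::int. g [^]\<^bsub>integer_group \<times>\<times> integer_group\<^esub> n)"
    using * unfolding group.cyclic_group[OF grp] by blast
  have pow: "g [^]\<^bsub>integer_group \<times>\<times> integer_group\<^esub> n = (n * fst g, n * snd g)" for n :: int
    using hom_int_pow[OF hom(1) _ grp group_integer_group, of g n]
      hom_int_pow[OF hom(2) _ grp group_integer_group, of g n]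
    by (simp add: prod_eq_iff mult.commute)
  have "(1, 0) \<in> carrier (integer_group \<times>\<times> integer_group)"
    "(0, 1) \<in> carrier (integer_group \<times>\<times> integer_group)" by simp_all
  then obtain m n where "(1, 0) = (m * fst g, m * snd g)" "(0, 1) = (n * fst g, n * snd g)"
    unfolding g pow by blast
  then show False by auto
qed

lemma (in group) subgroup_centralizer:
  assumes "S \<subseteq> carrier G"
  shows "subgroup {g \<in> carrier G. \<forall>s\<in>S. g \<otimes> s = s \<otimes> g} G"
proof (rule subgroupI)
  show "{g \<in> carrier G. \<forall>s\<in>S. g \<otimes> s = s \<otimes> g} \<noteq> {}" using assms by (auto intro!: exI[of _ \<one>])
  fix g assume g: "g \<in> {g \<in> carrier G. \<forall>s\<in>S. g \<otimes> s = s \<otimes> g}"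
  have "inv g \<otimes> s = s \<otimes> inv g" if "s \<in> S" for s
  proof -
    have s: "s \<in> carrier G" and gs: "g \<otimes> s = s \<otimes> g" using g that assms by auto
    have "inv g \<otimes> s = inv g \<otimes> (s \<otimes> g) \<otimes> inv g" using g s by (simp add: m_assoc)
    also have "\<dots> = s \<otimes> inv g" using g s by (simp flip: gs m_assoc)
    finally show ?thesis .
  qed
  then show "inv g \<in> {g \<in> carrier G. \<forall>s\<in>S. g \<otimes> s = s \<otimes> g}" using g by simp
  fix h assume h: "h \<in> {g \<in> carrier G. \<forall>s\<in>S. g \<otimes> s = s \<otimes> g}"
  have "g \<otimes> h \<otimes> s = s \<otimes> (g \<otimes> h)" if "s \<in> S" for s
  proof -
    have s: "s \<in> carrier G" and gs: "g \<otimes> s = s \<otimes> g" and hs: "h \<otimes> s = s \<otimes> h"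
      using g h that assms by auto
    have "g \<otimes> h \<otimes> s = g \<otimes> s \<otimes> h" using g h s by (simp add: m_assoc hs)
    also have "\<dots> = s \<otimes> (g \<otimes> h)" using g h s by (simp add: gs m_assoc)
    finally show ?thesis .
  qed
  then show "g \<otimes> h \<in> {g \<in> carrier G. \<forall>s\<in>S. g \<otimes> s = s \<otimes> g}" using g h by simp
qed (use assms in auto)

text \<open>The centralizer is used twice: first the generated subgroup centralizes
  \<open>S\<close>; hence \<open>S\<close>, and with it the generated subgroup, centralizes the
  generated subgroup.\<close>

lemma (in group) comm_group_subgroup_generatedI:
  assumes S: "S \<subseteq> carrier G" and comm: "\<And>s t. \<lbrakk>s \<in> S; t \<in> S\<rbrakk> \<Longrightarrow> s \<otimes> t = t \<otimes> s"
  shows "comm_group (subgroup_generated G S)"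
proof -
  let ?C = "\<lambda>T. {g \<in> carrier G. \<forall>s\<in>T. g \<otimes> s = s \<otimes> g}"
  have "generate G S \<subseteq> ?C S"
    using S comm by (intro generate_subgroup_incl subgroup_centralizer) auto
  then have "S \<subseteq> ?C (generate G S)" using S by fastforce
  then have "generate G S \<subseteq> ?C (generate G S)"
    using S by (intro generate_subgroup_incl subgroup_centralizer generate_incl)
  moreover have "carrier (subgroup_generated G S) = generate G S"
    using S by (simp add: carrier_subgroup_generated Int_absorb1)
  ultimately show ?thesis
    by (intro group.group_comm_groupI group_subgroup_generated) auto
qed

section \<open>Abelian self-similar groups on the binary tree\<close>

text \<open>The product rules are the wreath recursion with the right factor acting first: the
  section of \<open>g\<close> is taken at the letter to which \<open>h\<close> moves the given one.
  \<open>faithful\<close> is a coinduction principle; stated for section-closed sets, it keeps words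
  and levels of the tree out of the algebra.\<close>

locale self_similar_comm_group = comm_group G for G (structure) +
  fixes active :: "'a \<Rightarrow> bool" and s0 s1 :: "'a \<Rightarrow> 'a"
  assumes sections_closed [simp]: "g \<in> carrier G \<Longrightarrow> s0 g \<in> carrier G" "g \<in> carrier G \<Longrightarrow> s1 g \<in> carrier G"
    and active_mult: "\<lbrakk>g \<in> carrier G; h \<in> carrier G\<rbrakk> \<Longrightarrow> active (g \<otimes> h) \<longleftrightarrow> active g \<noteq> active h"
    and s0_mult: "\<lbrakk>g \<in> carrier G; h \<in> carrier G\<rbrakk> \<Longrightarrow> s0 (g \<otimes> h) = (if active h then s1 g else s0 g) \<otimes> s0 h"
    and s1_mult: "\<lbrakk>g \<in> carrier G; h \<in> carrier G\<rbrakk> \<Longrightarrow> s1 (g \<otimes> h) = (if active h then s0 g else s1 g) \<otimes> s1 h"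
    and faithful: "\<lbrakk>S \<subseteq> carrier G; \<And>g. g \<in> S \<Longrightarrow> \<not> active g \<and> s0 g \<in> S \<and> s1 g \<in> S\<rbrakk> \<Longrightarrow> S \<subseteq> {\<one>}"
begin

section \<open>Sections of active and inactive elements\<close>

lemma not_active_one [simp]: "\<not> active \<one>"
  using active_mult[of \<one> \<one>] by simp

lemma sections_one [simp]: "s0 \<one> = \<one>" "s1 \<one> = \<one>"
proof -
  have "s0 \<one> \<otimes> s0 \<one> = s0 \<one>" "s1 \<one> \<otimes> s1 \<one> = s1 \<one>"
    using s0_mult[of \<one> \<one>] s1_mult[of \<one> \<one>] by simp_all
  then show "s0 \<one> = \<one>" "s1 \<one> = \<one>" using r_cancel_one' by fastforce+
qed

text \<open>Compare the sections of \<open>a \<otimes> h\<close> and \<open>h \<otimes> a\<close> at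
  0: in the second, \<open>a\<close> has moved 0 to 1, so \<open>s1 h\<close> appears where the
  first has \<open>s0 h\<close>.\<close>

lemma s1_inactive:
  assumes "a \<in> carrier G" "active a" "h \<in> carrier G" "\<not> active h"
  shows "s1 h = s0 h"
proof -
  have "s0 a \<otimes> s0 h = s1 h \<otimes> s0 a"
    using s0_mult[of a h] s0_mult[of h a] m_comm[of a h] assms by simp
  then show ?thesis using assms by (metis m_comm right_cancel sections_closed)
qed

text \<open>The same comparison for two active elements. This relation drives both the criteria for
  exponent 2 and the redundancy with two active states.\<close>

lemma active_sections:
  assumes "a \<in> carrier G" "active a" "b \<in> carrier G" "active b"
  shows "s0 a \<otimes> s1 b = s1 a \<otimes> s0 b"
  using s0_mult[of a b] s0_mult[of b a] m_comm[of a b] m_comm[of "s0 a" "s1 b"] assms by simp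

lemma fixed_point_trivial:
  assumes "a \<in> carrier G" "active a" "h \<in> carrier G" "\<not> active h" "s0 h = h"
  shows "h = \<one>"
  using faithful[of "{h}"] s1_inactive[OF assms(1-4)] assms by auto

text \<open>The quotient \<open>k\<close> of the two elements is inactive with trivial sections, so
  \<open>{k, \<one>}\<close> is closed under sections.\<close>

lemma s0_inj_inactive:
  assumes "a \<in> carrier G" "active a" "g \<in> carrier G" "\<not> active g" "h \<in> carrier G" "\<not> active h"
    and "s0 g = s0 h"
  shows "g = h"
proof -
  define k where "k = g \<otimes> inv h"
  have k: "k \<in> carrier G" "g = k \<otimes> h" using assms by (simp_all add: k_def m_assoc)
  then have "\<not> active k" using active_mult[of k h] assms by auto
  moreover have "s0 k \<otimes> s0 h = s0 h" using s0_mult[of k h] k assms by simp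
  then have "s0 k = \<one>" using k assms r_cancel_one' by auto
  ultimately have "{k, \<one>} \<subseteq> {\<one>}"
    using s1_inactive[of a k] k(1) assms(1,2) by (intro faithful) auto
  then show ?thesis using k assms by simp
qed

lemma s0_inj_active:
  assumes "g \<in> carrier G" "active g" "h \<in> carrier G" "active h" "s0 g = s0 h"
  shows "g = h"
proof -
  define k where "k = g \<otimes> inv h"
  have k: "k \<in> carrier G" "g = k \<otimes> h" using assms by (simp_all add: k_def m_assoc)
  then have nk: "\<not> active k" using active_mult[of k h] assms by auto
  \<comment> \<open>The active factor \<open>h\<close> moves 0 to 1, so here it is the section of
    \<open>k\<close> at 1 that comes out trivial; \<open>s1_inactive\<close> transfers this to
    0.\<close>
  moreover have "s1 k \<otimes> s0 h = s0 h" using s0_mult[of k h] k assms by simp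
  then have "s1 k = \<one>" using k assms r_cancel_one' by auto
  ultimately have "{k, \<one>} \<subseteq> {\<one>}"
    using s1_inactive[OF assms(1,2) k(1) nk] k(1) by (intro faithful) auto
  then show ?thesis using k assms by simp
qed

section \<open>Criteria for exponent 2 and the torsion dichotomy\<close>

lemma elementary_2_if_section_products_square:
  assumes "\<And>g. \<lbrakk>g \<in> carrier G; active g\<rbrakk> \<Longrightarrow> \<exists>h\<in>carrier G. s0 g \<otimes> s1 g = h \<otimes> h"
  shows "elementary_2 G"
proof -
  let ?S = "{g \<otimes> g | g. g \<in> carrier G}"
  \<comment> \<open>The sections of a square are squares of sections if \<open>g\<close> is
    inactive, and the product of the two sections if \<open>g\<close> is active; the assumption
    makes the latter a square as well.\<close>
  have "?S \<subseteq> {\<one>}"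
  proof (rule faithful)
    fix s assume "s \<in> ?S"
    then obtain g where g: "g \<in> carrier G" "s = g \<otimes> g" by blast
    show "\<not> active s \<and> s0 s \<in> ?S \<and> s1 s \<in> ?S"
    proof (cases "active g")
      case True
      then obtain h where "h \<in> carrier G" "s0 g \<otimes> s1 g = h \<otimes> h" using assms g by blast
      then show ?thesis
        using g True m_comm[of "s0 g" "s1 g"] by (auto simp: active_mult s0_mult s1_mult)
    qed (use g in \<open>auto simp: active_mult s0_mult s1_mult\<close>)
  qed auto
  then show ?thesis by (auto simp: elementary_2_def)
qed

text \<open>By \<open>active_sections\<close>, one active element with equal sections forces equal
  sections on all active elements, so their section products are squares.\<close>

lemma elementary_2_if_equal_sections:
  assumes a: "a \<in> carrier G" "active a" "s0 a = s1 a"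
  shows "elementary_2 G"
proof (rule elementary_2_if_section_products_square)
  fix g assume g: "g \<in> carrier G" "active g"
  have "s1 a \<otimes> s1 g = s1 a \<otimes> s0 g" using active_sections[OF a(1,2) g] a by simp
  then have "s1 g = s0 g" using a g by simp
  then show "\<exists>h\<in>carrier G. s0 g \<otimes> s1 g = h \<otimes> h" using g by auto
qed

text \<open>The involution has mutually inverse sections, so for active \<open>g\<close> the
  relation \<open>active_sections\<close> gives s1 g = (s0 a)^-2 (s0 g). The section product of
  \<open>g\<close> is then the square of (s0 a)^-1 (s0 g).\<close>

lemma elementary_2_if_active_involution:
  assumes a: "a \<in> carrier G" "active a" "a \<otimes> a = \<one>"
  shows "elementary_2 G"
proof (rule elementary_2_if_section_products_square)
  fix g assume g: "g \<in> carrier G" "active g"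
  have "s1 a \<otimes> s0 a = \<one>" using s0_mult[of a a] a by simp
  then have "s1 a = inv (s0 a)" using a by (simp add: inv_equality)
  then have eq: "s0 a \<otimes> s1 g = inv (s0 a) \<otimes> s0 g" using active_sections[OF a(1,2) g] by simp
  have "s1 g = inv (s0 a) \<otimes> (s0 a \<otimes> s1 g)" using a g by (simp flip: m_assoc)
  then have "s1 g = inv (s0 a) \<otimes> (inv (s0 a) \<otimes> s0 g)" by (simp add: eq)
  then have "s0 g \<otimes> s1 g = (inv (s0 a) \<otimes> s0 g) \<otimes> (inv (s0 a) \<otimes> s0 g)"
    using a g by (simp add: m_ac)
  then show "\<exists>h\<in>carrier G. s0 g \<otimes> s1 g = h \<otimes> h" using a g by auto
qed

lemma pow_inactive:
  assumes "g \<in> carrier G" "\<not> active g"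
  shows "\<not> active (g [^] (n::nat)) \<and> s0 (g [^] n) = s0 g [^] n \<and> s1 (g [^] n) = s1 g [^] n"
  using assms by (induction n) (simp_all add: active_mult s0_mult s1_mult)

lemma active_pow: "g \<in> carrier G \<Longrightarrow> active (g [^] (n::nat)) \<longleftrightarrow> active g \<and> odd n"
  by (induction n) (auto simp: active_mult)

lemma elementary_2_or_torsion_free: "elementary_2 G \<or> torsion_free G"
proof (rule disjCI)
  define P where "P n \<longleftrightarrow> 0 < n \<and> (\<exists>g\<in>carrier G. g [^] n = \<one> \<and> g \<noteq> \<one>)" for n :: nat
  assume "\<not> torsion_free G"
  then have "\<exists>n. P n" by (auto simp: torsion_free_def P_def)
  define n where "n = (LEAST n. P n)"
  have Pn: "P n" unfolding n_def using \<open>\<exists>n. P n\<close> by (metis LeastI)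
  have least: "\<not> P m" if "m < n" for m using that not_less_Least unfolding n_def by blast
  obtain g where g: "g \<in> carrier G" "g [^] n = \<one>" "g \<noteq> \<one>" and n0: "0 < n"
    using Pn by (auto simp: P_def)
  let ?S = "{h \<in> carrier G. h [^] n = \<one>}"
  \<comment> \<open>On inactive elements sections commute with powers, so an n-torsion subgroup
    without active members would be closed under sections, hence trivial.\<close>
  have "\<exists>a\<in>?S. active a"
  proof (rule ccontr)
    assume "\<not> ?thesis"
    then have inactive: "\<not> active h" if "h \<in> ?S" for h using that by blast
    have "?S \<subseteq> {\<one>}"
    proof (rule faithful)
      fix h assume h: "h \<in> ?S"
      then have hG: "h \<in> carrier G" and hn: "h [^] n = \<one>" and na: "\<not> active h"
        using inactive by blast+
      from pow_inactive[OF hG na, of n] have "s0 h [^] n = \<one>" "s1 h [^] n = \<one>"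
        by (simp_all add: hn eq_commute[of \<one>])
      then show "\<not> active h \<and> s0 h \<in> ?S \<and> s1 h \<in> ?S" using hG na by simp
    qed auto
    then show False using g by blast
  qed
  then obtain a where a: "a \<in> carrier G" "a [^] n = \<one>" "active a" by blast
  have "even n" using active_pow[OF a(1), of n] a by auto
  then obtain m where m: "n = 2 * m" by blast
  have "m < n" "0 < m" using n0 m by auto
  \<comment> \<open>Minimality of \<open>n\<close> is applied to the square of \<open>a\<close>,
    which is killed by the smaller exponent \<open>m\<close>.\<close>
  have "(a [^] (2::nat)) [^] m = \<one>" using a m by (simp add: nat_pow_pow)
  then have "a [^] (2::nat) = \<one>"
    using least[OF \<open>m < n\<close>] \<open>0 < m\<close> a(1) unfolding P_def by blast
  then have "a \<otimes> a = \<one>" using a by (simp add: numeral_2_eq_2)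
  then show "elementary_2 G" using elementary_2_if_active_involution a by blast
qed

section \<open>Redundant generators in the torsion-free case\<close>

lemma redundant_generator:
  assumes "{x, y, z} \<subseteq> carrier G" "carrier G = generate G {x, y, z}"
    and "g \<in> {x, y, z}" "g \<in> generate G ({x, y, z} - {g})"
  shows "\<exists>p\<in>carrier G. \<exists>q\<in>carrier G. carrier G = generate G {p, q}"
proof -
  have two: ?thesis if p: "p \<in> {x, y, z}" and q: "q \<in> {x, y, z}" and *: "{x, y, z} - {g} \<subseteq> {p, q}" for p q
  proof -
    have pq: "p \<in> carrier G" "q \<in> carrier G" using p q assms(1) by blast+
    have s: "subgroup (generate G {p, q}) G" using pq by (intro generate_is_subgroup) blast
    have "g \<in> generate G {p, q}" using assms(4) mono_generate[OF *] by blast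
    moreover have "{p, q} \<subseteq> generate G {p, q}" by (rule subsetI) (rule generate.incl)
    ultimately have "{x, y, z} \<subseteq> generate G {p, q}" using * by blast
    then have "generate G {x, y, z} \<subseteq> generate G {p, q}" by (rule generate_subgroup_incl[OF _ s])
    then have "carrier G = generate G {p, q}" using assms(2) subgroup.subset[OF s] by simp
    then show ?thesis using pq by blast
  qed
  consider "g = x" | "g = y" | "g = z" using assms(3) by blast
  then show ?thesis
  proof cases
    case 1
    show ?thesis by (rule two[of y z]) (use 1 in blast)+
  next
    case 2
    show ?thesis by (rule two[of x z]) (use 2 in blast)+
  next
    case 3
    show ?thesis by (rule two[of x y]) (use 3 in blast)+
  qed
qed

text \<open>The words come from equating exponents. The section of z^i y^j x^(2k) at 0 is y^i x^j
  P^k, where P is the product of the sections of \<open>x\<close>. The fixed words are y x^2 for P =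
  x y, z y x^2 for P = x z, and z y^2 x^2 for P = y z.\<close>

lemma chain_redundant:
  assumes x: "x \<in> carrier G" "active x" "s0 x \<in> {x, y, z}" "s1 x \<in> {x, y, z}"
    and y: "y \<in> carrier G" "\<not> active y" "s0 y = x" and z: "z \<in> carrier G" "\<not> active z" "s0 z = y"
    and d: "x \<noteq> y" "y \<noteq> z" "x \<noteq> z" and ne: "\<not> elementary_2 G"
  shows "y \<in> generate G ({x, y, z} - {y}) \<or> z \<in> generate G ({x, y, z} - {z})"
proof -
  \<comment> \<open>Distinct sections leave six ordered pairs; commutativity reduces them to three
    products.\<close>
  have "s0 x \<noteq> s1 x" using elementary_2_if_equal_sections x ne by blast
  then have "s0 x = x \<and> s1 x = y \<or> s0 x = y \<and> s1 x = x \<or> s0 x = x \<and> s1 x = z \<or>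
      s0 x = z \<and> s1 x = x \<or> s0 x = y \<and> s1 x = z \<or> s0 x = z \<and> s1 x = y"
    using x(3,4) by (elim insertE emptyE) simp_all
  then consider "s1 x \<otimes> s0 x = x \<otimes> y" | "s1 x \<otimes> s0 x = x \<otimes> z" | "s1 x \<otimes> s0 x = y \<otimes> z"
    using m_comm[OF y(1) x(1)] m_comm[OF z(1) x(1)] m_comm[OF z(1) y(1)]
    by (elim disjE conjE) simp_all
  then show ?thesis
  proof cases
    case 1
    have "s0 (y \<otimes> (x \<otimes> x)) = s0 y \<otimes> (s1 x \<otimes> s0 x)"
      using x(1,2) y(1,2) z(1,2) by (simp add: active_mult s0_mult)
    also have "\<dots> = x \<otimes> (x \<otimes> y)" by (simp only: y(3) z(3) 1)
    also have "\<dots> = y \<otimes> (x \<otimes> x)" using x(1) y(1) z(1) by (simp add: m_ac)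
    finally have "y \<otimes> (x \<otimes> x) = \<one>"
      using x(1,2) y(1,2) z(1,2) by (intro fixed_point_trivial[OF x(1,2)]) (auto simp: active_mult)
    then have "y = inv (x \<otimes> x)" using x y by (metis inv_equality m_closed)
    then have "y = inv x \<otimes> inv x" using x y by (simp add: inv_mult)
    moreover have "inv x \<otimes> inv x \<in> generate G ({x, y, z} - {y})"
      using d by (intro generate.eng generate.inv) auto
    ultimately show ?thesis by metis
  next
    case 2
    have "s0 (z \<otimes> (y \<otimes> (x \<otimes> x))) = s0 z \<otimes> (s0 y \<otimes> (s1 x \<otimes> s0 x))"
      using x(1,2) y(1,2) z(1,2) by (simp add: active_mult s0_mult)
    also have "\<dots> = y \<otimes> (x \<otimes> (x \<otimes> z))" by (simp only: y(3) z(3) 2)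
    also have "\<dots> = z \<otimes> (y \<otimes> (x \<otimes> x))" using x(1) y(1) z(1) by (simp add: m_ac)
    finally have "z \<otimes> (y \<otimes> (x \<otimes> x)) = \<one>"
      using x(1,2) y(1,2) z(1,2) by (intro fixed_point_trivial[OF x(1,2)]) (auto simp: active_mult)
    then have "z = inv (y \<otimes> (x \<otimes> x))" using x y z by (metis inv_equality m_closed)
    then have "z = inv y \<otimes> (inv x \<otimes> inv x)" using x y by (simp add: inv_mult)
    moreover have "inv y \<otimes> (inv x \<otimes> inv x) \<in> generate G ({x, y, z} - {z})"
      using d by (intro generate.eng generate.inv) auto
    ultimately show ?thesis by metis
  next
    case 3
    have "s0 (z \<otimes> (y \<otimes> y \<otimes> (x \<otimes> x))) = s0 z \<otimes> (s0 y \<otimes> s0 y \<otimes> (s1 x \<otimes> s0 x))"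
      using x(1,2) y(1,2) z(1,2) by (simp add: active_mult s0_mult)
    also have "\<dots> = y \<otimes> (x \<otimes> x \<otimes> (y \<otimes> z))" by (simp only: y(3) z(3) 3)
    also have "\<dots> = z \<otimes> (y \<otimes> y \<otimes> (x \<otimes> x))" using x(1) y(1) z(1) by (simp add: m_ac)
    finally have "z \<otimes> (y \<otimes> y \<otimes> (x \<otimes> x)) = \<one>"
      using x(1,2) y(1,2) z(1,2) by (intro fixed_point_trivial[OF x(1,2)]) (auto simp: active_mult)
    then have "z = inv (y \<otimes> y \<otimes> (x \<otimes> x))" using x y z by (metis inv_equality m_closed)
    then have "z = inv y \<otimes> inv y \<otimes> (inv x \<otimes> inv x)" using x y by (simp add: inv_mult)
    moreover have "inv y \<otimes> inv y \<otimes> (inv x \<otimes> inv x) \<in> generate G ({x, y, z} - {z})"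
      using d by (intro generate.eng generate.inv) auto
    ultimately show ?thesis by metis
  qed
qed

text \<open>Injectivity of \<open>s0\<close> on inactive elements leaves few transition patterns. A
  fixed inactive state or a swapped pair is closed under sections, hence trivial; otherwise the
  inactive states form a chain ending in \<open>x\<close>.\<close>

lemma one_active_redundant:
  assumes x: "x \<in> carrier G" "active x" "s0 x \<in> {x, y, z}" "s1 x \<in> {x, y, z}"
    and y: "y \<in> carrier G" "\<not> active y" "s0 y \<in> {x, y, z}"
    and z: "z \<in> carrier G" "\<not> active z" "s0 z \<in> {x, y, z}"
    and d: "x \<noteq> y" "y \<noteq> z" "x \<noteq> z" and ne: "\<not> elementary_2 G"
  shows "y \<in> generate G ({x, y, z} - {y}) \<or> z \<in> generate G ({x, y, z} - {z})"
proof -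
  have ne': "s0 y \<noteq> s0 z" using s0_inj_inactive[OF x(1,2) y(1,2) z(1,2)] d by blast
  consider "s0 y = y" | "s0 z = z" | "s0 y = z" "s0 z = y" | "s0 y = x" "s0 z = y" | "s0 y = z" "s0 z = x"
    using y z ne' by auto
  then show ?thesis
  proof cases
    case 1
    then have "y = \<one>" using fixed_point_trivial x y by blast
    then show ?thesis by (simp add: generate.one)
  next
    case 2
    then have "z = \<one>" using fixed_point_trivial x z by blast
    then show ?thesis by (simp add: generate.one)
  next
    case 3
    have "{y, z} \<subseteq> {\<one>}"
      using faithful[of "{y, z}"] s1_inactive[OF x(1,2) y(1,2)] s1_inactive[OF x(1,2) z(1,2)] 3 y z
      by auto
    then show ?thesis by (simp add: generate.one)
  next
    case 4
    then show ?thesis using chain_redundant x y z d ne by blast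
  next
    case 5
    have "{x, z, y} = {x, y, z}" by auto
    then show ?thesis using chain_redundant[of x z y] x y z d ne 5 by auto
  qed
qed

text \<open>Among the four sections only the coincidences \<open>s0 x = s1 y\<close> and
  \<open>s1 x = s0 y\<close> survive. Unless both occur, the relation \<open>active_sections\<close>
  isolates a section different from the other factors. That section is the redundant generator,
  which may be neither \<open>x\<close> nor \<open>y\<close>.\<close>

lemma two_active_redundant:
  assumes tf: "torsion_free G" and ne: "\<not> elementary_2 G" and X: "X \<subseteq> carrier G"
    and x: "x \<in> X" "active x" "s0 x \<in> X" "s1 x \<in> X"
    and y: "y \<in> X" "active y" "s0 y \<in> X" "s1 y \<in> X" and d: "x \<noteq> y"
  shows "\<exists>g\<in>X. g \<in> generate G (X - {g})"
proof -
  have c: "x \<in> carrier G" "y \<in> carrier G" "s0 x \<in> carrier G" "s1 x \<in> carrier G"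
      "s0 y \<in> carrier G" "s1 y \<in> carrier G" using x y X by auto
  have eq: "s0 x \<otimes> s1 y = s1 x \<otimes> s0 y" using active_sections x y c by blast
  have 1: "s0 x \<noteq> s1 x" "s0 y \<noteq> s1 y" using elementary_2_if_equal_sections x y c ne by blast+
  have 2: "s0 x \<noteq> s0 y" using s0_inj_active x y c d by blast
  have 3: "s1 x \<noteq> s1 y"
  proof
    assume "s1 x = s1 y"
    then have "s0 x = s0 y" using eq c m_comm by (metis right_cancel)
    then show False using 2 by simp
  qed
  show ?thesis
  proof (cases "s0 x = s1 y")
    case False
    have "s1 y = inv (s0 x) \<otimes> (s0 x \<otimes> s1 y)" using c by (simp flip: m_assoc)
    then have "s1 y = inv (s0 x) \<otimes> (s1 x \<otimes> s0 y)" by (simp add: eq)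
    moreover have "inv (s0 x) \<otimes> (s1 x \<otimes> s0 y) \<in> generate G (X - {s1 y})"
      using 1 3 False x y by (intro generate.eng generate.inv generate.incl) auto
    ultimately show ?thesis using y by metis
  next
    case True
    \<comment> \<open>With both coincidences the relation would equate the squares of
      \<open>s0 x\<close> and \<open>s1 x\<close>; torsion-freeness would then make these two
      sections equal, which is excluded.\<close>
    have "s1 x \<noteq> s0 y"
    proof
      assume *: "s1 x = s0 y"
      then have sq: "s0 x \<otimes> s0 x = s1 x \<otimes> s1 x" using eq True by simp
      have "(s0 x \<otimes> inv (s1 x)) [^] (2::nat) = (s0 x \<otimes> s0 x) \<otimes> inv (s1 x \<otimes> s1 x)"
        using c by (simp add: numeral_2_eq_2 m_ac inv_mult)
      also have "\<dots> = \<one>" using c by (simp add: sq)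
      finally have "s0 x \<otimes> inv (s1 x) = \<one>"
        using tf c unfolding torsion_free_def by (meson inv_closed m_closed zero_less_numeral)
      then have "inv (inv (s1 x)) = s0 x" using c by (intro inv_equality) auto
      then have "s0 x = s1 x" using c by simp
      then show False using 1 by simp
    qed
    have "s0 y = inv (s1 x) \<otimes> (s1 x \<otimes> s0 y)" using c by (simp flip: m_assoc)
    then have "s0 y = inv (s1 x) \<otimes> (s0 x \<otimes> s0 x)" using eq True by simp
    moreover have "inv (s1 x) \<otimes> (s0 x \<otimes> s0 x) \<in> generate G (X - {s0 y})"
      using 2 \<open>s1 x \<noteq> s0 y\<close> x by (intro generate.eng generate.inv generate.incl) auto
    ultimately show ?thesis using y by metis
  qed
qed

lemma two_generators:
  assumes tf: "torsion_free G" and ne: "\<not> elementary_2 G" and X: "X = {x, y, z}" "X \<subseteq> carrier G"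
    and gen: "carrier G = generate G X" and closed: "\<And>g. g \<in> X \<Longrightarrow> s0 g \<in> X \<and> s1 g \<in> X"
    and x: "active x"
  shows "\<exists>p\<in>carrier G. \<exists>q\<in>carrier G. carrier G = generate G {p, q}"
proof (cases "x = y \<or> y = z \<or> x = z")
  case True
  then have "X = {x, y} \<or> X = {x, z}" using X by auto
  moreover have "x \<in> carrier G" "y \<in> carrier G" "z \<in> carrier G" using X by auto
  ultimately show ?thesis using gen by blast
next
  case False
  have "\<exists>g\<in>X. g \<in> generate G (X - {g})"
  proof (cases "active y \<or> active z")
    case True
    then show ?thesis
      using two_active_redundant[OF tf ne X(2), of x y] two_active_redundant[OF tf ne X(2), of x z]
        False X closed x by auto
  next
    case inactive: False
    then show ?thesis
      using one_active_redundant[of x y z] X closed x False ne by auto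
  qed
  then obtain g where "g \<in> {x, y, z}" "g \<in> generate G ({x, y, z} - {g})"
    unfolding X(1) by blast
  then show ?thesis
    using X(2) gen unfolding X(1) by (intro redundant_generator[of x y z g])
qed

lemma classification:
  assumes X: "X = {x, y, z}" "X \<subseteq> carrier G"
    and gen: "carrier G = generate G X" and closed: "\<And>g. g \<in> X \<Longrightarrow> s0 g \<in> X \<and> s1 g \<in> X"
  shows "carrier G = {\<one>} \<or> G \<cong> C\<^sub>2 \<or> G \<cong> C\<^sub>2 \<times>\<times> C\<^sub>2 \<or> G \<cong> C\<^sub>2 \<times>\<times> C\<^sub>2 \<times>\<times> C\<^sub>2 \<or>
    G \<cong> integer_group \<or> G \<cong> integer_group \<times>\<times> integer_group"
proof (cases "elementary_2 G")
  case True
  then show ?thesis using elementary_2_three_generators[of x y z] X gen by auto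
next
  case False
  then have tf: "torsion_free G" using elementary_2_or_torsion_free by blast
  show ?thesis
  proof (cases "\<exists>g\<in>X. active g")
    case False
    have "X \<subseteq> {\<one>}" using faithful[OF X(2)] closed False by blast
    then have "carrier G \<subseteq> {\<one>}" using gen generate_subgroup_incl[OF _ triv_subgroup] by blast
    then show ?thesis by auto
  next
    case True
    \<comment> \<open>The three instances below place each generator in turn in the first position,
      which \<open>two_generators\<close> reserves for an active one.\<close>
    then have "\<exists>p\<in>carrier G. \<exists>q\<in>carrier G. carrier G = generate G {p, q}"
      using two_generators[OF tf False _ X(2) gen closed, of x y z]
        two_generators[OF tf False _ X(2) gen closed, of y x z]
        two_generators[OF tf False _ X(2) gen closed, of z x y] X by auto
    then obtain p q where "p \<in> carrier G" "q \<in> carrier G" "carrier G = generate G {p, q}" by blast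
    then show ?thesis using torsion_free_generate_pair_cases[OF tf] by blast
  qed
qed

section \<open>Recognising Z and Z^2 from a wreath recursion\<close>

lemma active_inv: "g \<in> carrier G \<Longrightarrow> active (inv g) \<longleftrightarrow> active g"
  using active_mult[of "inv g" g] by simp

lemma s0_inv_inactive: "\<lbrakk>g \<in> carrier G; \<not> active g\<rbrakk> \<Longrightarrow> s0 (inv g) = inv (s0 g)"
  using s0_mult[of "inv g" g] by (simp add: inv_equality)

lemma active_int_pow: "g \<in> carrier G \<Longrightarrow> active (g [^] (i::int)) \<longleftrightarrow> active g \<and> odd i"
  by (cases i rule: int_cases2) (simp_all add: int_pow_int int_pow_neg_int active_inv active_pow)

lemma s0_int_pow_inactive:
  "\<lbrakk>g \<in> carrier G; \<not> active g\<rbrakk> \<Longrightarrow> s0 (g [^] (i::int)) = s0 g [^] i"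
  by (cases i rule: int_cases2)
    (simp_all add: int_pow_int int_pow_neg_int s0_inv_inactive pow_inactive)

text \<open>Abstract form of automaton 771, whose state b is trivial: a = \<sigma>(c, 1) and c = (a,
  a). Since a^2 has section c and c has section a, the section of a relation between a and c is
  again such a relation, with smaller exponents.\<close>

lemma iso_integer_group_squaredI:
  assumes a: "a \<in> carrier G" "active a" "s0 a = c" "s1 a = \<one>"
    and c: "c \<in> carrier G" "\<not> active c" "s0 c = a"
    and gen: "carrier G = generate G {a, c}"
  shows "G \<cong> integer_group \<times>\<times> integer_group"
proof (rule iso_integer_group_squared[OF a(1) c(1) gen])
  fix i j :: int assume "a [^] i \<otimes> c [^] j = \<one>"
  then show "i = 0 \<and> j = 0"
    \<comment> \<open>Taking sections passes from \<open>(i, j)\<close> to \<open>(j, i div 2)\<close>;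
      the weights 3 and 4 make this a strict descent.\<close>
  proof (induction "nat (3 * \<bar>i\<bar> + 4 * \<bar>j\<bar>)" arbitrary: i j rule: less_induct)
    case less
    have "\<not> active (a [^] i \<otimes> c [^] j)" using less.prems by simp
    then have "even i" using a c by (simp add: active_mult active_int_pow)
    then obtain k where k: "i = 2 * k" by blast
    have "a [^] i = (a \<otimes> a) [^] k"
      using a by (simp add: k int_pow_distrib flip: int_pow_mult)
    then have "s0 (a [^] i) = c [^] k"
      using a c by (simp add: s0_int_pow_inactive active_mult s0_mult)
    then have "s0 (a [^] i \<otimes> c [^] j) = c [^] k \<otimes> a [^] j"
      using a c by (simp add: s0_mult active_int_pow s0_int_pow_inactive)
    then have eq: "a [^] j \<otimes> c [^] k = \<one>" using less.prems a c m_comm by simp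
    show ?case
    proof (rule ccontr)
      assume "\<not> (i = 0 \<and> j = 0)"
      then have "nat (3 * \<bar>j\<bar> + 4 * \<bar>k\<bar>) < nat (3 * \<bar>i\<bar> + 4 * \<bar>j\<bar>)" unfolding k by linarith
      then have "j = 0 \<and> k = 0" using less.hyps eq by blast
      then show False using \<open>\<not> (i = 0 \<and> j = 0)\<close> k by simp
    qed
  qed
qed

text \<open>Abstract form of automaton 731: a = \<sigma>(b, a) and b = (a, a). The inactive word b a
  a equals its own section, so b = a^-2 and \<open>a\<close> alone generates.\<close>

lemma iso_integer_groupI:
  assumes a: "a \<in> carrier G" "active a" "s0 a = b" "s1 a = a"
    and b: "b \<in> carrier G" "\<not> active b" "s0 b = a"
    and gen: "carrier G = generate G {a, b}"
  shows "G \<cong> integer_group"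
proof (rule iso_integer_group[OF a(1)])
  have a1: "a \<noteq> \<one>" using a(2) by auto
  have "s0 (b \<otimes> (a \<otimes> a)) = a \<otimes> (a \<otimes> b)"
    using a b by (simp add: active_mult s0_mult)
  also have "\<dots> = b \<otimes> (a \<otimes> a)" using a b by (simp add: m_ac)
  finally have baa: "b \<otimes> (a \<otimes> a) = \<one>"
    using a b by (intro fixed_point_trivial[OF a(1,2)]) (auto simp: active_mult)
  \<comment> \<open>Exponent 2 would turn \<open>baa\<close> into \<open>b = \<one>\<close>, and
    then a = s0 b would be trivial although it is active.\<close>
  have "torsion_free G"
  proof (rule ccontr)
    assume "\<not> torsion_free G"
    then have "a \<otimes> a = \<one>" using elementary_2_or_torsion_free a(1) by (auto simp: elementary_2_def)
    then have "b = \<one>" using baa b by simp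
    then show False using b(3) a1 by simp
  qed
  then show "i = 0" if "a [^] i = \<one>" for i :: int
    using torsion_free_int_pow a(1) a1 that by blast
  have "b = inv (a \<otimes> a)" using baa a b by (metis inv_equality m_closed)
  then have "b = inv a \<otimes> inv a" using a by (simp add: inv_mult)
  then have "b \<in> generate G {a}" by (auto intro: generate.eng generate.inv)
  then show "carrier G = generate G {a}"
    using generate_insert_redundant[of "{a}" b] gen a by (simp add: insert_commute)
qed

end

section \<open>Automaton groups\<close>

text \<open>\<open>tl\<close> drops the image of the first letter whatever it is; the restriction
  makes the section extensional, as group elements have to be.\<close>

definition tree_section :: "('q, 'x) automaton \<Rightarrow> 'x \<Rightarrow> ('x list \<Rightarrow> 'x list) \<Rightarrow> 'x list \<Rightarrow> 'x list"
  where "tree_section A x g = restrict (\<lambda>w. tl (g (x # w))) (lists (alphabet A))"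

lemma tree_autsD:
  assumes "g \<in> tree_auts X"
  shows "g \<in> Bij (lists X)" "g [] = []" "w \<in> lists X \<Longrightarrow> g w \<in> lists X"
  using assms Bij_imp_funcset[of g "lists X"] by (auto simp: tree_auts_def)

lemma mult_tree_aut_group:
  assumes "g \<in> tree_auts X" "h \<in> tree_auts X" "w \<in> lists X"
  shows "(g \<otimes>\<^bsub>tree_aut_group X\<^esub> h) w = g (h w)"
  using assms(3) tree_autsD(1)[OF assms(1)] tree_autsD(1)[OF assms(2)]
  by (simp add: tree_aut_group_def BijGroup_def compose_eq)

lemma one_tree_aut_group: "\<one>\<^bsub>tree_aut_group X\<^esub> = (\<lambda>w\<in>lists X. w)"
  by (simp add: tree_aut_group_def BijGroup_def)

lemma carrier_tree_aut_group [simp]: "carrier (tree_aut_group X) = tree_auts X"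
  by (simp add: tree_aut_group_def)

lemma inv_tree_aut_group:
  assumes "g \<in> tree_auts X" "w \<in> lists X"
  shows "(inv\<^bsub>tree_aut_group X\<^esub> g) (g w) = w" "g ((inv\<^bsub>tree_aut_group X\<^esub> g) w) = w"
proof -
  interpret group "tree_aut_group X" by (rule group_tree_aut_group)
  have i: "inv\<^bsub>tree_aut_group X\<^esub> g \<in> tree_auts X" using inv_closed assms by simp
  show "(inv\<^bsub>tree_aut_group X\<^esub> g) (g w) = w"
    using mult_tree_aut_group[OF i assms] l_inv[of g] assms by (simp add: one_tree_aut_group)
  show "g ((inv\<^bsub>tree_aut_group X\<^esub> g) w) = w"
    using mult_tree_aut_group[OF assms(1) i assms(2)] r_inv[of g] assms by (simp add: one_tree_aut_group)
qed

lemma one_automaton_group: "\<one>\<^bsub>automaton_group A\<^esub> = (\<lambda>w\<in>lists (alphabet A). w)"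
  by (simp add: automaton_group_def one_tree_aut_group)

lemma mult_automaton_group_eq: "mult (automaton_group A) = mult (tree_aut_group (alphabet A))"
  by (simp add: automaton_group_def)

lemma automaton_group_subset: "carrier (automaton_group A) \<subseteq> tree_auts (alphabet A)"
  unfolding automaton_group_def
  using group.carrier_subgroup_generated_subset[OF group_tree_aut_group[of "alphabet A"]] by simp

lemma mult_automaton_group:
  assumes "g \<in> carrier (automaton_group A)" "h \<in> carrier (automaton_group A)" "w \<in> lists (alphabet A)"
  shows "(g \<otimes>\<^bsub>automaton_group A\<^esub> h) w = g (h w)"
  using assms automaton_group_subset by (auto simp: mult_automaton_group_eq intro!: mult_tree_aut_group)

lemma automaton_group_eqI:
  assumes "g \<in> carrier (automaton_group A)" "h \<in> carrier (automaton_group A)"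
    and "\<And>w. w \<in> lists (alphabet A) \<Longrightarrow> g w = h w"
  shows "g = h"
proof (rule extensionalityI)
  show "g \<in> extensional (lists (alphabet A))" "h \<in> extensional (lists (alphabet A))"
    using assms(1,2) automaton_group_subset tree_autsD(1) Bij_imp_extensional by blast+
qed (rule assms(3))

lemma state_aut_apply: "w \<in> lists (alphabet A) \<Longrightarrow> state_aut A q w = act A q w"
  by (simp add: state_aut_def)

lemma carrier_automaton_group:
  assumes "invertible_automaton A"
  shows "carrier (automaton_group A) = generate (tree_aut_group (alphabet A)) (state_aut A ` states A)"
proof -
  have "state_aut A ` states A \<subseteq> carrier (tree_aut_group (alphabet A))"
    using state_aut_in_carrier[OF assms] by blast
  then show ?thesis
    unfolding automaton_group_def carrier_subgroup_generated by (simp only: Int_absorb1)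
qed

lemma state_aut_in_automaton_group:
  assumes "invertible_automaton A" "q \<in> states A"
  shows "state_aut A q \<in> carrier (automaton_group A)"
  using assms by (simp add: carrier_automaton_group generate.incl)

text \<open>The definition generates inside the full tree automorphism group, while the abstract
  classification speaks of generation inside \<open>G\<close> itself; this bridges the two.\<close>

lemma automaton_group_generated:
  assumes "invertible_automaton A"
  shows "carrier (automaton_group A) = generate (automaton_group A) (state_aut A ` states A)"
proof -
  have "carrier (automaton_group A) =
      carrier (subgroup_generated (automaton_group A) (state_aut A ` states A))"
    unfolding automaton_group_def using group.subgroup_generated2[OF group_tree_aut_group] by metis
  also have "\<dots> = generate (automaton_group A) (carrier (automaton_group A) \<inter> state_aut A ` states A)"
    by (rule carrier_subgroup_generated)
  also have "carrier (automaton_group A) \<inter> state_aut A ` states A = state_aut A ` states A"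
    using state_aut_in_automaton_group[OF assms] by blast
  finally show ?thesis .
qed

lemma comm_automaton_groupI:
  assumes A: "invertible_automaton A"
    and comm: "\<And>q r w. \<lbrakk>q \<in> states A; r \<in> states A; w \<in> lists (alphabet A)\<rbrakk> \<Longrightarrow>
      act A q (act A r w) = act A r (act A q w)"
  shows "comm_group (automaton_group A)"
  unfolding automaton_group_def
proof (rule group.comm_group_subgroup_generatedI[OF group_tree_aut_group])
  show "state_aut A ` states A \<subseteq> carrier (tree_aut_group (alphabet A))"
    using state_aut_in_carrier[OF A] by blast
  fix s t assume st: "s \<in> state_aut A ` states A" "t \<in> state_aut A ` states A"
  then have c: "s \<in> carrier (automaton_group A)" "t \<in> carrier (automaton_group A)"
    using state_aut_in_automaton_group[OF A] by auto
  interpret group "automaton_group A" by (rule group_automaton_group)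
  have "s \<otimes>\<^bsub>automaton_group A\<^esub> t = t \<otimes>\<^bsub>automaton_group A\<^esub> s"
  proof (rule automaton_group_eqI)
    fix w assume w: "w \<in> lists (alphabet A)"
    obtain q p where "q \<in> states A" "s = state_aut A q" "p \<in> states A" "t = state_aut A p"
      using st by blast
    then show "(s \<otimes>\<^bsub>automaton_group A\<^esub> t) w = (t \<otimes>\<^bsub>automaton_group A\<^esub> s) w"
      unfolding mult_automaton_group[OF c w] mult_automaton_group[OF c(2,1) w]
      using comm[of q p w] w act_in_lists[OF A] by (simp add: state_aut_apply del: in_lists_conv_set)
  qed (use c in auto)
  then show "s \<otimes>\<^bsub>tree_aut_group (alphabet A)\<^esub> t = t \<otimes>\<^bsub>tree_aut_group (alphabet A)\<^esub> s"
    by (simp add: mult_automaton_group_eq)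
qed

text \<open>Self-similarity, by induction on generated elements. The letter \<open>x\<close> must
  vary, because in a product the left factor is met at the letter produced by the right one.\<close>

lemma automaton_group_sections_exist:
  assumes A: "invertible_automaton A" and g: "g \<in> carrier (automaton_group A)"
    and x: "x \<in> alphabet A"
  shows "\<exists>y\<in>alphabet A. \<exists>h\<in>carrier (automaton_group A). \<forall>w\<in>lists (alphabet A). g (x # w) = y # h w"
  using g x unfolding carrier_automaton_group[OF A]
proof (induction g arbitrary: x rule: generate.induct)
  case one
  then show ?case
    by (intro bexI[of _ x] bexI[of _ "\<one>\<^bsub>tree_aut_group (alphabet A)\<^esub>"] generate.one)
      (auto simp: one_tree_aut_group)
next
  case (incl s)
  then obtain q where q: "q \<in> states A" "s = state_aut A q" by blast
  have n: "next_state A q x \<in> states A" "out_letter A q x \<in> alphabet A"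
    using A q incl.prems by (auto simp: invertible_automaton_def bij_betw_apply)
  then show ?case using q incl.prems
    by (intro bexI[of _ "out_letter A q x"] bexI[of _ "state_aut A (next_state A q x)"] generate.incl imageI)
      (auto simp: state_aut_def)
next
  case (inv s)
  then obtain q where q: "q \<in> states A" "s = state_aut A q" by blast
  have "out_letter A q ` alphabet A = alphabet A"
    using A q by (auto simp: invertible_automaton_def bij_betw_def)
  \<comment> \<open>The section of an inverse at \<open>x\<close> is the inverse of the section of
    \<open>s\<close> at the preimage \<open>y\<close> of \<open>x\<close>.\<close>
  then obtain y where y: "y \<in> alphabet A" "out_letter A q y = x" using inv.prems by force
  have n: "next_state A q y \<in> states A" using A q y by (auto simp: invertible_automaton_def)
  let ?t = "state_aut A (next_state A q y)"
  let ?T = "tree_aut_group (alphabet A)"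
  have st: "s \<in> tree_auts (alphabet A)" "?t \<in> tree_auts (alphabet A)"
    using state_aut_in_carrier[OF A] q n by auto
  then have it: "inv\<^bsub>?T\<^esub> ?t \<in> tree_auts (alphabet A)"
    using group.inv_closed[OF group_tree_aut_group] by fastforce
  have "(inv\<^bsub>?T\<^esub> s) (x # w) = y # (inv\<^bsub>?T\<^esub> ?t) w" if w: "w \<in> lists (alphabet A)" for w
  proof -
    have iw: "(inv\<^bsub>?T\<^esub> ?t) w \<in> lists (alphabet A)" by (rule tree_autsD(3)[OF it w])
    have "s (y # (inv\<^bsub>?T\<^esub> ?t) w) = x # act A (next_state A q y) ((inv\<^bsub>?T\<^esub> ?t) w)"
      using iw y by (simp add: q state_aut_apply)
    also have "act A (next_state A q y) ((inv\<^bsub>?T\<^esub> ?t) w) = ?t ((inv\<^bsub>?T\<^esub> ?t) w)"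
      by (rule state_aut_apply[OF iw, symmetric])
    also have "\<dots> = w" by (rule inv_tree_aut_group(2)[OF st(2) w])
    finally have "s (y # (inv\<^bsub>?T\<^esub> ?t) w) = x # w" .
    moreover have "(inv\<^bsub>?T\<^esub> s) (s (y # (inv\<^bsub>?T\<^esub> ?t) w)) = y # (inv\<^bsub>?T\<^esub> ?t) w"
      using iw y by (intro inv_tree_aut_group(1)[OF st(1)]) simp
    ultimately show ?thesis by simp
  qed
  then show ?case using y n
    by (intro bexI[of _ y] bexI[of _ "inv\<^bsub>?T\<^esub> ?t"] generate.inv) auto
next
  case (eng g h)
  let ?T = "tree_aut_group (alphabet A)"
  obtain y k where k: "y \<in> alphabet A" "k \<in> generate ?T (state_aut A ` states A)"
    "\<And>w. w \<in> lists (alphabet A) \<Longrightarrow> h (x # w) = y # k w"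
    using eng.IH(2)[OF eng.prems] by blast
  obtain z l where l: "z \<in> alphabet A" "l \<in> generate ?T (state_aut A ` states A)"
    "\<And>w. w \<in> lists (alphabet A) \<Longrightarrow> g (y # w) = z # l w"
    using eng.IH(1)[OF k(1)] by blast
  have sub: "generate ?T (state_aut A ` states A) \<subseteq> tree_auts (alphabet A)"
    using automaton_group_subset[of A] carrier_automaton_group[OF A] by simp
  have "(g \<otimes>\<^bsub>?T\<^esub> h) (x # w) = z # (l \<otimes>\<^bsub>?T\<^esub> k) w" if w: "w \<in> lists (alphabet A)" for w
  proof -
    have gh: "g \<in> tree_auts (alphabet A)" "h \<in> tree_auts (alphabet A)"
      and lk: "l \<in> tree_auts (alphabet A)" "k \<in> tree_auts (alphabet A)"
      using sub eng.hyps k l by auto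
    have "(g \<otimes>\<^bsub>?T\<^esub> h) (x # w) = g (h (x # w))"
      using w eng.prems by (intro mult_tree_aut_group[OF gh]) simp
    also have "\<dots> = z # l (k w)"
      using k(3)[OF w] l(3)[OF tree_autsD(3)[OF lk(2) w]] by simp
    also have "l (k w) = (l \<otimes>\<^bsub>?T\<^esub> k) w" by (rule mult_tree_aut_group[OF lk w, symmetric])
    finally show ?thesis .
  qed
  then show ?case using l(1) generate.eng[OF l(2) k(2)] by blast
qed

text \<open>The existential witnesses are unique: the empty word determines the letter, and
  extensionality identifies the remaining map with \<open>tree_section\<close>.\<close>

lemma automaton_group_sections:
  assumes A: "invertible_automaton A" and g: "g \<in> carrier (automaton_group A)"
    and x: "x \<in> alphabet A"
  shows "tree_section A x g \<in> carrier (automaton_group A)"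
    and "hd (g [x]) \<in> alphabet A"
    and "w \<in> lists (alphabet A) \<Longrightarrow> g (x # w) = hd (g [x]) # tree_section A x g w"
proof -
  obtain y h where y: "y \<in> alphabet A" and h: "h \<in> carrier (automaton_group A)"
    and gx: "\<And>w. w \<in> lists (alphabet A) \<Longrightarrow> g (x # w) = y # h w"
    using automaton_group_sections_exist[OF assms] by blast
  have "h \<in> extensional (lists (alphabet A))" "h [] = []"
    using h automaton_group_subset tree_autsD Bij_imp_extensional by blast+
  then have "tree_section A x g = h" "hd (g [x]) = y"
    using gx by (auto simp: tree_section_def extensional_def restrict_def)
  then show "tree_section A x g \<in> carrier (automaton_group A)" "hd (g [x]) \<in> alphabet A"
    "w \<in> lists (alphabet A) \<Longrightarrow> g (x # w) = hd (g [x]) # tree_section A x g w"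
    using y h gx by auto
qed

lemma tree_section_state_aut:
  assumes "x \<in> alphabet A"
  shows "tree_section A x (state_aut A q) = state_aut A (next_state A q x)"
  using assms by (auto simp: tree_section_def state_aut_def fun_eq_iff)

lemma tree_section_mult:
  assumes A: "invertible_automaton A" and g: "g \<in> carrier (automaton_group A)"
    and h: "h \<in> carrier (automaton_group A)" and x: "x \<in> alphabet A"
  shows "tree_section A x (g \<otimes>\<^bsub>automaton_group A\<^esub> h) =
    tree_section A (hd (h [x])) g \<otimes>\<^bsub>automaton_group A\<^esub> tree_section A x h"
proof (rule automaton_group_eqI)
  interpret group "automaton_group A" by (rule group_automaton_group)
  note hx = automaton_group_sections[OF A h x]
  show "tree_section A x (g \<otimes>\<^bsub>automaton_group A\<^esub> h) \<in> carrier (automaton_group A)"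
    "tree_section A (hd (h [x])) g \<otimes>\<^bsub>automaton_group A\<^esub> tree_section A x h \<in> carrier (automaton_group A)"
    using automaton_group_sections(1)[OF A _ x] automaton_group_sections(1)[OF A g hx(2)] hx(1) g h
    by simp_all
  fix w assume w: "w \<in> lists (alphabet A)"
  have sw: "tree_section A x h w \<in> lists (alphabet A)"
    using hx(1) w automaton_group_subset tree_autsD(3) by blast
  have xw: "x # w \<in> lists (alphabet A)" using x w by simp
  have "tree_section A x (g \<otimes>\<^bsub>automaton_group A\<^esub> h) w = tl (g (h (x # w)))"
    unfolding tree_section_def using w mult_automaton_group[OF g h xw] by simp
  also have "\<dots> = tree_section A (hd (h [x])) g (tree_section A x h w)"
    unfolding hx(3)[OF w] automaton_group_sections(3)[OF A g hx(2) sw] by simp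
  also have "\<dots> = (tree_section A (hd (h [x])) g \<otimes>\<^bsub>automaton_group A\<^esub> tree_section A x h) w"
    using mult_automaton_group[OF automaton_group_sections(1)[OF A g hx(2)] hx(1) w] by simp
  finally show "tree_section A x (g \<otimes>\<^bsub>automaton_group A\<^esub> h) w =
    (tree_section A (hd (h [x])) g \<otimes>\<^bsub>automaton_group A\<^esub> tree_section A x h) w" .
qed

text \<open>Induction on the word with \<open>g\<close> ranging over \<open>S\<close>: the first
  letter stays fixed, and another member of \<open>S\<close> acts on the rest.\<close>

lemma automaton_group_eq_one_if_inactive:
  assumes A: "invertible_automaton A" and S: "S \<subseteq> carrier (automaton_group A)"
    and inactive: "\<And>g x. \<lbrakk>g \<in> S; x \<in> alphabet A\<rbrakk> \<Longrightarrow> hd (g [x]) = x \<and> tree_section A x g \<in> S"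
  shows "S \<subseteq> {\<one>\<^bsub>automaton_group A\<^esub>}"
proof
  fix g assume g: "g \<in> S"
  have "g w = w" if "w \<in> lists (alphabet A)" for w
    using that g
  proof (induction w arbitrary: g rule: lists.induct)
    case Nil
    then show ?case using S automaton_group_subset tree_autsD(2) by blast
  next
    case (Cons x w)
    then show ?case
      using automaton_group_sections(3)[OF A, of g x w] inactive S by (auto simp del: in_lists_conv_set)
  qed
  then show "g \<in> {\<one>\<^bsub>automaton_group A\<^esub>}"
    using g S monoid.one_closed[OF group.is_monoid[OF group_automaton_group, of A]]
    by (auto simp: one_automaton_group intro!: automaton_group_eqI[of _ A])
qed

lemma automaton_group_self_similar:
  assumes A: "invertible_automaton A" and X: "alphabet A = {u, v}" "u \<noteq> v"
    and comm: "comm_group (automaton_group A)"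
  shows "self_similar_comm_group (automaton_group A) (\<lambda>g. g [u] = [v]) (tree_section A u) (tree_section A v)"
proof -
  interpret comm_group "automaton_group A" by (rule comm)
  have uv: "u \<in> alphabet A" "v \<in> alphabet A" using X by auto
  \<comment> \<open>On two letters injectivity leaves only the swap and the identity, so the image
    of \<open>[u]\<close> alone decides activity.\<close>
  have root: "if g [u] = [v] then g [v] = [u] else g [u] = [u] \<and> g [v] = [v]"
    if g: "g \<in> carrier (automaton_group A)" for g
  proof -
    have "tree_section A x g [] = []" if "x \<in> alphabet A" for x
      using automaton_group_sections(1)[OF A g that] automaton_group_subset tree_autsD(2) by blast
    then have 1: "g [x] = [hd (g [x])]" "hd (g [x]) \<in> {u, v}" if "x \<in> alphabet A" for x
      using automaton_group_sections(2)[OF A g that] automaton_group_sections(3)[OF A g that, of "[]"] X that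
      by auto
    have "g \<in> Bij (lists (alphabet A))" using g automaton_group_subset tree_autsD(1) by blast
    then have "inj_on g (lists (alphabet A))" by (simp add: Bij_def bij_betw_def)
    then have "g [u] \<noteq> g [v]" using uv X(2) by (auto dest!: inj_onD[of _ _ "[u]" "[v]"])
    then show ?thesis using 1(1)[OF uv(1)] 1(2)[OF uv(1)] 1(1)[OF uv(2)] 1(2)[OF uv(2)] by auto
  qed
  show ?thesis
  proof unfold_locales
    fix g assume g: "g \<in> carrier (automaton_group A)"
    show "tree_section A u g \<in> carrier (automaton_group A)" "tree_section A v g \<in> carrier (automaton_group A)"
      using automaton_group_sections(1)[OF A g] uv by blast+
    fix h assume h: "h \<in> carrier (automaton_group A)"
    have "(g \<otimes>\<^bsub>automaton_group A\<^esub> h) [u] = g (h [u])" using uv by (intro mult_automaton_group g h) simp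
    then show "(g \<otimes>\<^bsub>automaton_group A\<^esub> h) [u] = [v] \<longleftrightarrow> (g [u] = [v]) \<noteq> (h [u] = [v])"
      using root[OF g] root[OF h] X(2) by (auto split: if_splits)
    show "tree_section A u (g \<otimes>\<^bsub>automaton_group A\<^esub> h) =
        (if h [u] = [v] then tree_section A v g else tree_section A u g) \<otimes>\<^bsub>automaton_group A\<^esub> tree_section A u h"
      "tree_section A v (g \<otimes>\<^bsub>automaton_group A\<^esub> h) =
        (if h [u] = [v] then tree_section A u g else tree_section A v g) \<otimes>\<^bsub>automaton_group A\<^esub> tree_section A v h"
      using tree_section_mult[OF A g h uv(1)] tree_section_mult[OF A g h uv(2)] root[OF h] by (auto split: if_splits)
  next
    fix S assume S: "S \<subseteq> carrier (automaton_group A)"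
      and cl: "\<And>g. g \<in> S \<Longrightarrow> g [u] \<noteq> [v] \<and> tree_section A u g \<in> S \<and> tree_section A v g \<in> S"
    show "S \<subseteq> {\<one>\<^bsub>automaton_group A\<^esub>}"
    proof (rule automaton_group_eq_one_if_inactive[OF A S])
      fix g x assume g: "g \<in> S" and x: "x \<in> alphabet A"
      have "g \<in> carrier (automaton_group A)" using g S by blast
      then show "hd (g [x]) = x \<and> tree_section A x g \<in> S"
        using root[of g] cl[OF g] x X by (auto split: if_splits)
    qed
  qed
qed

lemma abelian_automaton_group_cases:
  assumes "automaton_3_2 A" "comm_group (automaton_group A)"
  shows "carrier (automaton_group A) = {\<one>\<^bsub>automaton_group A\<^esub>} \<or> automaton_group A \<cong> C\<^sub>2 \<or>
    automaton_group A \<cong> C\<^sub>2 \<times>\<times> C\<^sub>2 \<or> automaton_group A \<cong> C\<^sub>2 \<times>\<times> C\<^sub>2 \<times>\<times> C\<^sub>2 \<or>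
    automaton_group A \<cong> integer_group \<or> automaton_group A \<cong> integer_group \<times>\<times> integer_group"
proof -
  have A: "invertible_automaton A" using assms by (simp add: automaton_3_2_def)
  obtain u v where X: "alphabet A = {u, v}" "u \<noteq> v"
    using assms(1) by (auto simp: automaton_3_2_def card_2_iff)
  obtain p q r where Q: "states A = {p, q, r}"
    using assms(1) by (auto simp: automaton_3_2_def card_3_iff)
  interpret self_similar_comm_group "automaton_group A" "\<lambda>g. g [u] = [v]" "tree_section A u" "tree_section A v"
    by (rule automaton_group_self_similar[OF A X assms(2)])
  show ?thesis
  proof (rule classification[of "state_aut A ` states A" "state_aut A p" "state_aut A q" "state_aut A r"])
    show "state_aut A ` states A \<subseteq> carrier (automaton_group A)"
      using state_aut_in_automaton_group[OF A] by blast
    show "carrier (automaton_group A) = generate (automaton_group A) (state_aut A ` states A)"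
      by (rule automaton_group_generated[OF A])
    fix g assume "g \<in> state_aut A ` states A"
    then show "tree_section A u g \<in> state_aut A ` states A \<and> tree_section A v g \<in> state_aut A ` states A"
      using A X by (auto simp: tree_section_state_aut invertible_automaton_def)
  qed (simp add: Q)
qed

lemma state_aut_eq_one:
  assumes "\<And>w. w \<in> lists (alphabet A) \<Longrightarrow> act A q w = w"
  shows "state_aut A q = \<one>\<^bsub>automaton_group A\<^esub>"
  unfolding one_automaton_group state_aut_def using assms by (rule restrict_ext)

text \<open>This merges the states \<open>qb\<close> and \<open>qc\<close> of automata 730 and
  731.\<close>

lemma state_aut_cong:
  assumes "\<And>x. next_state A q x = next_state A r x" "\<And>x. out_letter A q x = out_letter A r x"
  shows "state_aut A q = state_aut A r"
proof -
  have "act A q = act A r"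
  proof
    show "act A q w = act A r w" for w using assms by (cases w) simp_all
  qed
  then show ?thesis by (simp add: state_aut_def)
qed

section \<open>The six examples\<close>

lemma wreath_automaton_simps [simp]:
  "states (wreath_automaton ra rb rc) = {qa, qb, qc}"
  "alphabet (wreath_automaton ra rb rc) = {0, 1}"
  "next_state (wreath_automaton ra rb rc) q x =
    (if x = 0 then fst (snd (case_abc ra rb rc q)) else snd (snd (case_abc ra rb rc q)))"
  "out_letter (wreath_automaton ra rb rc) q x = fst (case_abc ra rb rc q) x"
  by (simp_all add: wreath_automaton_def Let_def case_prod_beta)

lemma automaton_3_2_wreath:
  assumes "fst ra \<in> {id, swap01}" "fst rb \<in> {id, swap01}" "fst rc \<in> {id, swap01}"
  shows "automaton_3_2 (wreath_automaton ra rb rc)"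
proof -
  have "bij_betw id {0, 1::nat} {0, 1}" "bij_betw swap01 {0, 1} {0, 1}"
    by (auto simp: bij_betw_def inj_on_def)
  moreover have "q \<in> {qa, qb, qc}" for q by (cases q) auto
  moreover have "out_letter (wreath_automaton ra rb rc) q = fst (case_abc ra rb rc q)" for q by auto
  ultimately show ?thesis
    using assms by (auto simp: automaton_3_2_def invertible_automaton_def)
qed

lemmas aut_defs = aut1_def aut1090_def aut730_def aut802_def aut731_def aut771_def

definition examples :: "(abc, nat) automaton set"
  where "examples = {aut1, aut1090, aut730, aut802, aut731, aut771}"

lemma examplesI:
  "aut1 \<in> examples" "aut1090 \<in> examples" "aut730 \<in> examples"
  "aut802 \<in> examples" "aut731 \<in> examples" "aut771 \<in> examples"
  unfolding examples_def by blast+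

lemma examples_cases:
  assumes "A \<in> examples"
    and "A = aut1 \<Longrightarrow> P" "A = aut1090 \<Longrightarrow> P" "A = aut730 \<Longrightarrow> P"
    and "A = aut802 \<Longrightarrow> P" "A = aut731 \<Longrightarrow> P" "A = aut771 \<Longrightarrow> P"
  shows P
  using assms unfolding examples_def by blast

lemma states_examples: "states A = {qa, qb, qc}" if "A \<in> examples"
  using that by (rule examples_cases) (simp_all add: aut_defs)

lemma alphabet_examples: "alphabet A = {0, 1}" if "A \<in> examples"
  using that by (rule examples_cases) (simp_all add: aut_defs)

lemma automaton_3_2_examples: "automaton_3_2 A" if "A \<in> examples"
  using that by (rule examples_cases) (simp_all add: aut_defs automaton_3_2_wreath)

lemma invertible_examples: "invertible_automaton A" if "A \<in> examples"
  using automaton_3_2_examples[OF that] by (simp add: automaton_3_2_def)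

text \<open>Each example has at most one active state, and every inactive state moves to the same
  state on both letters. For distinct \<open>q\<close> and \<open>r\<close> the two products
  therefore agree on the first letter and continue with the same two states in opposite orders,
  which the induction hypothesis covers.\<close>

lemma comm_group_examples: "comm_group (automaton_group A)" if "A \<in> examples"
proof (rule comm_automaton_groupI[OF invertible_examples[OF that]])
  fix q r w assume "w \<in> lists (alphabet A)"
  then have "w \<in> lists {0, 1}" by (simp only: alphabet_examples[OF that])
  then show "act A q (act A r w) = act A r (act A q w)"
  proof (induction w arbitrary: q r)
    case (Cons x w)
    from that show ?case
      by (rule examples_cases; cases q; cases r) (use Cons in \<open>auto simp: aut_defs\<close>)
  qed simp
qed

lemma generators_examples:
  assumes "A \<in> examples"
  shows "state_aut A q \<in> carrier (automaton_group A)"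
    and "carrier (automaton_group A) =
      generate (automaton_group A) {state_aut A qa, state_aut A qb, state_aut A qc}"
proof -
  note A = invertible_examples[OF assms]
  have "q \<in> states A" by (cases q) (simp_all add: states_examples[OF assms])
  then show "state_aut A q \<in> carrier (automaton_group A)" by (rule state_aut_in_automaton_group[OF A])
  show "carrier (automaton_group A) =
      generate (automaton_group A) {state_aut A qa, state_aut A qb, state_aut A qc}"
    using automaton_group_generated[OF A] by (simp add: states_examples[OF assms])
qed

lemma self_similar_examples:
  assumes "A \<in> examples"
  shows "self_similar_comm_group (automaton_group A) (\<lambda>g. g [0] = [1]) (tree_section A 0) (tree_section A 1)"
  by (rule automaton_group_self_similar[OF invertible_examples alphabet_examples zero_neq_one
    comm_group_examples]) (fact assms)+

lemma automaton_group_aut1: "automaton_group aut1 \<cong> singleton_group ()"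
proof -
  interpret group "automaton_group aut1" by (rule group_automaton_group)
  have "act aut1 q w = w" for q w
    by (induction w arbitrary: q) (auto simp: aut1_def split: abc.split)
  then have "state_aut aut1 ` states aut1 = {\<one>\<^bsub>automaton_group aut1\<^esub>}"
    by (simp add: state_aut_eq_one states_examples[OF examplesI(1)])
  then have "carrier (automaton_group aut1) = {\<one>\<^bsub>automaton_group aut1\<^esub>}"
    using automaton_group_generated[OF invertible_examples[OF examplesI(1)]] generate_one by simp
  then show ?thesis by (rule trivial_iso_singleton_group)
qed

lemma automaton_group_aut1090: "automaton_group aut1090 \<cong> C\<^sub>2"
proof -
  note alphabet = alphabet_examples[OF examplesI(2)]
  let ?G = "automaton_group aut1090" and ?s = "state_aut aut1090"
  interpret self_similar_comm_group ?G "\<lambda>g. g [0] = [1]"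
    "tree_section aut1090 0" "tree_section aut1090 1"
    by (intro self_similar_examples examplesI)
  have s: "?s q \<in> carrier ?G" for q
    by (intro generators_examples(1) examplesI)
  \<comment> \<open>Membership of the word in \<open>lists (alphabet aut1090)\<close> is settled
    while the automaton is still folded; only then is it unfolded for computation.\<close>
  have act: "?s qa [0] = [1]"
    by (simp add: state_aut_apply alphabet) (simp add: aut1090_def)
  have el: "elementary_2 ?G"
    by (rule elementary_2_if_equal_sections[OF s act])
      (simp add: tree_section_state_aut alphabet, simp add: aut1090_def)
  have "act aut1090 q w = w" if "q \<noteq> qa" for q w
    using that by (induction w arbitrary: q) (auto simp: aut1090_def split: abc.split)
  then have one: "?s qb = \<one>\<^bsub>?G\<^esub>" "?s qc = \<one>\<^bsub>?G\<^esub>" by (simp_all add: state_aut_eq_one)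
  have "carrier ?G = generate ?G {\<one>\<^bsub>?G\<^esub>, ?s qa}"
    using generators_examples(2)[OF examplesI(2)] one by (simp add: insert_commute)
  also have "\<dots> = generate ?G {?s qa}"
    using s by (intro generate_insert_redundant) (auto intro: generate.one)
  finally have gen: "carrier ?G = generate ?G {?s qa}" .
  have "?s qa \<noteq> \<one>\<^bsub>?G\<^esub>" using act not_active_one by metis
  then show ?thesis using elementary_2_iso_C2[OF el s, of qa] by (simp flip: gen)
qed

lemma automaton_group_aut730: "automaton_group aut730 \<cong> C\<^sub>2 \<times>\<times> C\<^sub>2"
proof -
  note alphabet = alphabet_examples[OF examplesI(3)]
  let ?G = "automaton_group aut730" and ?s = "state_aut aut730"
  interpret self_similar_comm_group ?G "\<lambda>g. g [0] = [1]"
    "tree_section aut730 0" "tree_section aut730 1"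
    by (intro self_similar_examples examplesI)
  have s: "?s q \<in> carrier ?G" for q
    by (intro generators_examples(1) examplesI)
  have act: "?s qa [0] = [1]"
    by (simp add: state_aut_apply alphabet) (simp add: aut730_def)
  have el: "elementary_2 ?G"
    by (rule elementary_2_if_equal_sections[OF s act])
      (simp add: tree_section_state_aut alphabet, simp add: aut730_def)
  have "?s qc = ?s qb" by (rule state_aut_cong) (simp_all add: aut730_def)
  then have gen: "carrier ?G = generate ?G {?s qb, ?s qa}"
    using generators_examples(2)[OF examplesI(3)] by (simp add: insert_commute)
  have 1: "?s qa \<noteq> \<one>\<^bsub>?G\<^esub>" using act not_active_one by metis
  \<comment> \<open>\<open>qa\<close> flips every letter and \<open>qb\<close> every letter but the
    first, so two letters tell them apart from each other and from the identity.\<close>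
  have "?s qb [0, 0] = [0, 1]" "?s qa [0, 0] = [1, 1]" "\<one>\<^bsub>?G\<^esub> [0, 0] = [0, 0]"
    by (simp_all add: state_aut_apply alphabet one_automaton_group alphabet) (simp_all add: aut730_def)
  then have "?s qb \<notin> {\<one>\<^bsub>?G\<^esub>, ?s qa}" by auto
  then have "?s qb \<notin> generate ?G {?s qa}" using elementary_2_generate_singleton[OF el s] by simp
  then have "?G \<cong> C\<^sub>2 \<times>\<times> ?G\<lparr>carrier := generate ?G {?s qa}\<rparr>"
    using elementary_2_iso_C2_DirProd_generate[OF el, of "{?s qa}" "?s qb"] s by (simp flip: gen)
  then show ?thesis
    using C2_DirProd_iso[OF elementary_2_iso_C2[OF el s 1]] by (rule iso_trans)
qed

lemma automaton_group_aut802: "automaton_group aut802 \<cong> C\<^sub>2 \<times>\<times> C\<^sub>2 \<times>\<times> C\<^sub>2"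
proof -
  note alphabet = alphabet_examples[OF examplesI(4)]
  let ?G = "automaton_group aut802" and ?s = "state_aut aut802"
  interpret self_similar_comm_group ?G "\<lambda>g. g [0] = [1]"
    "tree_section aut802 0" "tree_section aut802 1"
    by (intro self_similar_examples examplesI)
  have s: "?s q \<in> carrier ?G" for q
    by (intro generators_examples(1) examplesI)
  have act: "?s qa [0] = [1]"
    by (simp add: state_aut_apply alphabet) (simp add: aut802_def)
  have el: "elementary_2 ?G"
    by (rule elementary_2_if_equal_sections[OF s act])
      (simp add: tree_section_state_aut alphabet, simp add: aut802_def)
  have gen: "carrier ?G = generate ?G {?s qb, ?s qc, ?s qa}"
    using generators_examples(2)[OF examplesI(4)] by (simp add: insert_commute)
  have 1: "?s qa \<noteq> \<one>\<^bsub>?G\<^esub>" using act not_active_one by metis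
  \<comment> \<open>\<open>qa\<close> flips all letters, \<open>qc\<close> all but the first,
    \<open>qb\<close> all but the first two, so \<open>qb\<close> first shows on the third letter.
    The value at \<open>[1, 1, 1]\<close> serves to evaluate the product of \<open>qc\<close> and
    \<open>qa\<close>.\<close>
  have w: "?s qb [0, 0, 0] = [0, 0, 1]" "?s qc [0, 0, 0] = [0, 1, 1]" "?s qa [0, 0, 0] = [1, 1, 1]"
    "?s qc [1, 1, 1] = [1, 0, 0]" "\<one>\<^bsub>?G\<^esub> [0, 0, 0] = [0, 0, 0]"
    by (simp_all add: state_aut_apply alphabet one_automaton_group alphabet) (simp_all add: aut802_def)
  have "(?s qc \<otimes>\<^bsub>?G\<^esub> ?s qa) [0, 0, 0] = [1, 0, 0]"
    using mult_automaton_group[OF s s, of "[0, 0, 0]" qc qa] w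
    by (simp add: alphabet)
  then have "?s qb \<notin> {\<one>\<^bsub>?G\<^esub>, ?s qa, ?s qc, ?s qc \<otimes>\<^bsub>?G\<^esub> ?s qa}" using w by auto
  then have 3: "?s qb \<notin> generate ?G {?s qc, ?s qa}"
    using elementary_2_generate_doubleton[OF el s s] by simp
  have "?s qc \<notin> {\<one>\<^bsub>?G\<^esub>, ?s qa}" using w by auto
  then have 2: "?s qc \<notin> generate ?G {?s qa}" using elementary_2_generate_singleton[OF el s] by simp
  have "?G \<cong> C\<^sub>2 \<times>\<times> ?G\<lparr>carrier := generate ?G {?s qc, ?s qa}\<rparr>"
    using elementary_2_iso_C2_DirProd_generate[OF el _ _ 3] s by (simp flip: gen)
  also have "\<dots> \<cong> C\<^sub>2 \<times>\<times> C\<^sub>2 \<times>\<times> ?G\<lparr>carrier := generate ?G {?s qa}\<rparr>"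
    using elementary_2_iso_C2_DirProd_generate[OF el _ _ 2] s by (intro C2_DirProd_iso) simp
  also have "\<dots> \<cong> C\<^sub>2 \<times>\<times> C\<^sub>2 \<times>\<times> C\<^sub>2"
    by (intro C2_DirProd_iso elementary_2_iso_C2[OF el s 1])
  finally show ?thesis .
qed

lemma automaton_group_aut731: "automaton_group aut731 \<cong> integer_group"
proof -
  note alphabet = alphabet_examples[OF examplesI(5)]
  let ?G = "automaton_group aut731" and ?s = "state_aut aut731"
  interpret self_similar_comm_group ?G "\<lambda>g. g [0] = [1]"
    "tree_section aut731 0" "tree_section aut731 1"
    by (intro self_similar_examples examplesI)
  have s: "?s q \<in> carrier ?G" for q
    by (intro generators_examples(1) examplesI)
  have "?s qc = ?s qb" by (rule state_aut_cong) (simp_all add: aut731_def)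
  then have gen: "carrier ?G = generate ?G {?s qa, ?s qb}"
    using generators_examples(2)[OF examplesI(5)] by (simp add: insert_commute)
  show ?thesis
    by (rule iso_integer_groupI[OF s _ _ _ s _ _ gen])
      (simp_all add: tree_section_state_aut alphabet state_aut_apply alphabet, simp_all add: aut731_def)
qed

lemma automaton_group_aut771: "automaton_group aut771 \<cong> integer_group \<times>\<times> integer_group"
proof -
  note alphabet = alphabet_examples[OF examplesI(6)]
  let ?G = "automaton_group aut771" and ?s = "state_aut aut771"
  interpret self_similar_comm_group ?G "\<lambda>g. g [0] = [1]"
    "tree_section aut771 0" "tree_section aut771 1"
    by (intro self_similar_examples examplesI)
  have s: "?s q \<in> carrier ?G" for q
    by (intro generators_examples(1) examplesI)
  have "act aut771 qb w = w" for w by (induction w) (auto simp: aut771_def)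
  then have b: "?s qb = \<one>\<^bsub>?G\<^esub>" by (simp add: state_aut_eq_one)
  have "carrier ?G = generate ?G {\<one>\<^bsub>?G\<^esub>, ?s qa, ?s qc}"
    using generators_examples(2)[OF examplesI(6)] b by (simp add: insert_commute)
  also have "\<dots> = generate ?G {?s qa, ?s qc}"
    using s by (intro generate_insert_redundant) (auto intro: generate.one)
  finally have gen: "carrier ?G = generate ?G {?s qa, ?s qc}" .
  have sect: "tree_section aut771 x (?s q) = ?s (next_state aut771 q x)" if "x = 0 \<or> x = 1" for q x
    by (rule tree_section_state_aut) (use that in \<open>simp add: alphabet\<close>)
  show ?thesis
  proof (rule iso_integer_group_squaredI[OF s _ _ _ s _ _ gen])
    show "tree_section aut771 1 (?s qa) = \<one>\<^bsub>?G\<^esub>"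
      unfolding b[symmetric] by (simp add: sect) (simp add: aut771_def)
  qed (simp_all add: sect state_aut_apply alphabet, simp_all add: aut771_def)
qed

section \<open>Comparing the groups through their abstract models\<close>

lemma iso_automaton_groupI:
  assumes "H \<cong> K" "automaton_group B \<cong> K"
  shows "H \<cong> automaton_group B"
  using assms(1) group.iso_sym[OF group_automaton_group assms(2)] by (rule iso_trans)

lemma examples_not_iso:
  "sorted_wrt (\<lambda>B C. \<not> automaton_group B \<cong> automaton_group C)
    [aut1, aut1090, aut730, aut802, aut731, aut771]"
proof -
  have c2: "card (carrier C\<^sub>2) = 2" by (simp add: carrier_integer_mod_group)
  have u2: "card (UNIV :: (int \<times> int) set) = 0"
    by (simp add: card_cartesian_product infinite_UNIV_int flip: UNIV_Times_UNIV)
  \<comment> \<open>\<open>card\<close> is 0 on infinite sets, so these values separate all pairs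
    except the two infinite groups.\<close>
  have card: "card (carrier (automaton_group aut1)) = 1" "card (carrier (automaton_group aut1090)) = 2"
    "card (carrier (automaton_group aut730)) = 4" "card (carrier (automaton_group aut802)) = 8"
    "card (carrier (automaton_group aut731)) = 0" "card (carrier (automaton_group aut771)) = 0"
    using automaton_group_aut1[THEN iso_same_card] automaton_group_aut1090[THEN iso_same_card]
      automaton_group_aut730[THEN iso_same_card] automaton_group_aut802[THEN iso_same_card]
      automaton_group_aut731[THEN iso_same_card] automaton_group_aut771[THEN iso_same_card]
    by (simp_all add: c2 u2 card_cartesian_product infinite_UNIV_int)
  have "\<not> automaton_group aut731 \<cong> automaton_group aut771"
  proof
    assume *: "automaton_group aut731 \<cong> automaton_group aut771"
    have "integer_group \<cong> automaton_group aut731"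
      by (rule group.iso_sym[OF group_automaton_group automaton_group_aut731])
    then have "integer_group \<cong> automaton_group aut771" using * by (rule iso_trans)
    then have "integer_group \<cong> integer_group \<times>\<times> integer_group"
      using automaton_group_aut771 by (rule iso_trans)
    then show False
      using isomorphic_group_cyclicity[of integer_group "integer_group \<times>\<times> integer_group"]
        integer_group_squared_not_cyclic DirProd_group[OF group_integer_group group_integer_group]
        by simp
  qed
  then show ?thesis using card by (auto dest!: iso_same_card)
qed

theorem theorem4:
  shows "(\<forall>B \<in> {aut1, aut1090, aut730, aut802, aut731, aut771}.
            automaton_3_2 B \<and> comm_group (automaton_group B)) \<and>
         automaton_group aut1 \<cong> singleton_group () \<and>
         automaton_group aut1090 \<cong> C\<^sub>2 \<and>
         automaton_group aut730 \<cong> C\<^sub>2 \<times>\<times> C\<^sub>2 \<and>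
         automaton_group aut802 \<cong> C\<^sub>2 \<times>\<times> C\<^sub>2 \<times>\<times> C\<^sub>2 \<and>
         automaton_group aut731 \<cong> integer_group \<and>
         automaton_group aut771 \<cong> integer_group \<times>\<times> integer_group \<and>
         sorted_wrt (\<lambda>B C. \<not> automaton_group B \<cong> automaton_group C)
           [aut1, aut1090, aut730, aut802, aut731, aut771] \<and>
         (\<forall>A :: ('q, 'x) automaton. automaton_3_2 A \<and> comm_group (automaton_group A) \<longrightarrow>
            (\<exists>B \<in> {aut1, aut1090, aut730, aut802, aut731, aut771}.
               automaton_group A \<cong> automaton_group B))"
  unfolding examples_def[symmetric]
proof (intro conjI allI impI ballI)
  fix A :: "('q, 'x) automaton"
  assume A: "automaton_3_2 A \<and> comm_group (automaton_group A)"
  have "carrier (automaton_group A) = {\<one>\<^bsub>automaton_group A\<^esub>} \<Longrightarrow> automaton_group A \<cong> singleton_group ()"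
    by (rule group.trivial_iso_singleton_group[OF group_automaton_group])
  then show "\<exists>B \<in> examples. automaton_group A \<cong> automaton_group B"
    using abelian_automaton_group_cases[of A] A examplesI iso_automaton_groupI[OF _ automaton_group_aut1]
      iso_automaton_groupI[OF _ automaton_group_aut1090] iso_automaton_groupI[OF _ automaton_group_aut730]
      iso_automaton_groupI[OF _ automaton_group_aut802] iso_automaton_groupI[OF _ automaton_group_aut731]
      iso_automaton_groupI[OF _ automaton_group_aut771]
    by meson
qed (fact automaton_3_2_examples comm_group_examples automaton_group_aut1
    automaton_group_aut1090 automaton_group_aut730 automaton_group_aut802 automaton_group_aut731
    automaton_group_aut771 examples_not_iso)+

end
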